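(* Let $(K,|\cdot|)$ be a non-Archimedean nontrivially valued field with residue field $k$ and ring of integers $D$, let $\varepsilon\in(0,1]$ and $n\ge2$. Let $R:=\mathbb{Z}$ (the prime ring of $K$) if $\operatorname{char}K\ne\operatorname{char}k$, and $R:=D$ otherwise. Then the union of any nonempty family of nonempty spheres in $K^n$ centered at $\mathbf 0$ is $\mathrm{SL}(n,R,\varepsilon)$-paradoxical using $5-(-1)^n$ pieces. In particular, $K^n\setminus\{\mathbf 0\}$ and $D^n\setminus\{\mathbf 0\}$ are $\mathrm{SL}(n,R,\varepsilon)$-paradoxical using $5-(-1)^n$ pieces.
   Context: A non-Archimedean valuation on a field $K$ is a function $|\cdot|:K\to[0,\infty)$ with $|x|=0\iff x=0$, $|xy|=|x||y|$, $|x+y|\le\max\{|x|,|y|\}$; it is nontrivial if $\{|x|:x\in K,x\neq0\}\ne\{1\}$. $D=\{x\in K:|x|\le1\}$ is the ring of integers, $\mathfrak m=\{x:|x|<1\}$ its maximal ideal, $k=D/\mathfrak m$ the residue field. If $\operatorname{char}K\neq\operatorname{char}k$ then $\operatorname{char}K=0$, and $\mathbb{Z}$ is regarded as a subring of $D$. $K^n$ carries the norm $\|x\|=\max_i|x_i|$; spheres centered at $\mathbf 0$ are the sets $S[\mathbf 0,r]=\{y\in K^n:\|y\|=r\}$, $r>0$. For a subring $R\subseteq D$ containing $1$ and $\varepsilon\in(0,1]$, $\mathrm{SL}(n,R,\varepsilon)$ is the group of matrices $[a_{ij}]\in\mathrm{SL}(n,R)$ with $|a_{ii}-1|<\varepsilon$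 for all $i$ and $|a_{ij}|<\varepsilon$ for all $i\neq j$; it acts on $K^n$ by matrix multiplication on column vectors. For a group $G$ acting on a set $X$ and $A,B\subseteq X$, write $A\sim_{G,m}B$ if there are partitions $A=\bigsqcup_{i=1}^mA_i$, $B=\bigsqcup_{i=1}^mB_i$ into (possibly empty) subsets and $g_1,\dots,g_m\in G$ with $g_i(A_i)=B_i$. A nonempty set $E\subseteq X$ is $G$-paradoxical using $s$ pieces if $E=A\sqcup B$ with $A\sim_{G,m}E$ and $B\sim_{G,l}E$ for some $m,l\ge1$ with $m+l=s$. The axiom of choice is assumed. *)

theory Defs
  imports
    "HOL-Analysis.Analysis"
    "HOL-Algebra.QuotRing"
    "HOL-Computational_Algebra.Computational_Algebra"
begin

section \<open>Non-Archimedean valued fields\<close>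

definition nonarch_valuation :: "('a::field \<Rightarrow> real) \<Rightarrow> bool" where
  "nonarch_valuation v \<longleftrightarrow>
     (\<forall>x. 0 \<le> v x) \<and> (\<forall>x. v x = 0 \<longleftrightarrow> x = 0) \<and>
     (\<forall>x y. v (x * y) = v x * v y) \<and> (\<forall>x y. v (x + y) \<le> max (v x) (v y))"

definition nontrivial_valuation :: "('a::field \<Rightarrow> real) \<Rightarrow> bool" where
  "nontrivial_valuation v \<longleftrightarrow> {v x | x. x \<noteq> 0} \<noteq> {1}"

definition integers_of :: "('a::field \<Rightarrow> real) \<Rightarrow> 'a set" where
  "integers_of v = {x. v x \<le> 1}"

definition max_ideal_of :: "('a::field \<Rightarrow> real) \<Rightarrow> 'a set" where
  "max_ideal_of v = {x. v x < 1}"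

definition integer_ring :: "('a::field \<Rightarrow> real) \<Rightarrow> 'a ring" where
  "integer_ring v =
     \<lparr>carrier = integers_of v, mult = (*), one = 1, zero = 0, add = (+)\<rparr>"

definition residue_field :: "('a::field \<Rightarrow> real) \<Rightarrow> 'a set ring" where
  "residue_field v = integer_ring v Quot max_ideal_of v"

text \<open>The counterpart of \<^const>\<open>semiring_char\<close> for rings given by a carrier.\<close>

definition ring_characteristic :: "('a, 'b) ring_scheme \<Rightarrow> nat" where
  "ring_characteristic A =
     (if \<exists>n::nat. 0 < n \<and> [n] \<cdot>\<^bsub>A\<^esub> \<one>\<^bsub>A\<^esub> = \<zero>\<^bsub>A\<^esub>
      then LEAST n::nat. 0 < n \<and> [n] \<cdot>\<^bsub>A\<^esub> \<one>\<^bsub>A\<^esub> = \<zero>\<^bsub>A\<^esub>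
      else 0)"

text \<open>
  In the mixed case, \<^term>\<open>CHAR('a::field)\<close> is 0, so \<^term>\<open>range of_int\<close>
  is a copy of the ring of rational integers in the field.
\<close>

definition coefficient_ring :: "('a::field \<Rightarrow> real) \<Rightarrow> 'a set" where
  "coefficient_ring v =
     (if CHAR('a) \<noteq> ring_characteristic (residue_field v)
      then range of_int else integers_of v)"

section \<open>Spheres and congruence subgroups of the special linear group\<close>

definition max_norm :: "('a \<Rightarrow> real) \<Rightarrow> 'a ^ 'n \<Rightarrow> real" where
  "max_norm v x = Max (range (\<lambda>i. v (x $ i)))"

definition zero_sphere :: "('a \<Rightarrow> real) \<Rightarrow> real \<Rightarrow> ('a ^ 'n) set" where
  "zero_sphere v r = {y. max_norm v y = r}"

definition SL_group ::
    "('a::field \<Rightarrow> real) \<Rightarrow> 'a set \<Rightarrow> real \<Rightarrow> ('a ^ 'n ^ 'n) monoid" where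
  "SL_group v R \<epsilon> =
     \<lparr>carrier = {A. (\<forall>i j. A $ i $ j \<in> R) \<and> det A = 1 \<and>
                    (\<forall>i. v (A $ i $ i - 1) < \<epsilon>) \<and>
                    (\<forall>i j. i \<noteq> j \<longrightarrow> v (A $ i $ j) < \<epsilon>)},
      mult = (**), one = mat 1\<rparr>"

section \<open>Paradoxical sets\<close>

text \<open>
  The action of \<open>G\<close> is given by \<open>\<phi>\<close>, where \<open>\<phi> g x\<close> is the
  image of \<open>x\<close> under \<open>g\<close>.
\<close>

definition equidecomposable ::
    "('g, 'b) monoid_scheme \<Rightarrow> ('g \<Rightarrow> 'x \<Rightarrow> 'x) \<Rightarrow> nat \<Rightarrow> 'x set \<Rightarrow> 'x set \<Rightarrow> bool" where
  "equidecomposable G \<phi> m A B \<longleftrightarrow>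
     (\<exists>P Q g. disjoint_family_on P {..<m} \<and> A = (\<Union>i<m. P i) \<and>
              disjoint_family_on Q {..<m} \<and> B = (\<Union>i<m. Q i) \<and>
              (\<forall>i<m. g i \<in> carrier G \<and> \<phi> (g i) ` P i = Q i))"

definition paradoxical ::
    "('g, 'b) monoid_scheme \<Rightarrow> ('g \<Rightarrow> 'x \<Rightarrow> 'x) \<Rightarrow> nat \<Rightarrow> 'x set \<Rightarrow> bool" where
  "paradoxical G \<phi> s E \<longleftrightarrow>
     E \<noteq> {} \<and>
     (\<exists>A B m l. E = A \<union> B \<and> A \<inter> B = {} \<and> 1 \<le> m \<and> 1 \<le> l \<and> m + l = s \<and>
        equidecomposable G \<phi> m A E \<and> equidecomposable G \<phi> l B E)"

end

theory Submission
  imports Defs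
begin

text \<open>
  Let \<open>R\<^sub>0\<close> be \<open>\<int>\<close> with the ordinary absolute value in mixed characteristic, and the ring of
  polynomials over the prime ring in an element \<open>t\<close> with \<open>0 < v t < 1\<close>, with the absolute value
  \<open>4 ^ degree\<close>, in equal characteristic. In both cases there are elements that are small for \<open>v\<close> but
  large in \<open>R\<^sub>0\<close>. They yield two matrices in \<open>SL(2, R\<^sub>0)\<close>, congruent to the identity, such that every
  nontrivial reduced word is conjugate to a product of matrices \<open>[[1, 0], [d, 1]] [[1, c], [0, 1]]\<close>
  with large \<open>c\<close> and \<open>d\<close>. The absolute value of its trace exceeds 2, so the word has no nonzero
  fixed vector in \<open>K\<^sup>2\<close>.

  For even \<open>n\<close> the block diagonal action of this free group on \<open>K\<^sup>n - {0}\<close> is free, which gives four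
  pieces. For odd \<open>n\<close> one coordinate axis \<open>L\<close> is fixed pointwise. On the complement \<open>X\<close> of \<open>L\<close> the
  action is free, and a transvection moves \<open>L\<close> to a subset \<open>D\<close> of \<open>X\<close> that meets every orbit at most
  once. Since the neutral element of a free group is not needed for its paradoxical decomposition,
  \<open>X - D\<close> splits into four pieces that cover \<open>X\<close> twice. Adding \<open>L\<close> to one covering and \<open>D\<close>, moved back
  to \<open>L\<close>, to the other one completes both, so even five pieces suffice.
\<close>

no_notation fps_nth (infixl "$" 75)

section \<open>Paradoxes of free actions\<close>

type_synonym letter = "bool \<times> bool"

text \<open>The first component of a letter names one of the two generators, the second tells
  whether it is inverted.\<close>

definition letter_inv :: "letter \<Rightarrow> letter" where
  "letter_inv l = (fst l, \<not> snd l)"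

lemma letter_inv_simps [simp]:
  "letter_inv (letter_inv l) = l" "letter_inv (b, c) = (b, \<not> c)" "letter_inv l \<noteq> l" "l \<noteq> letter_inv l"
  "letter_inv k = letter_inv l \<longleftrightarrow> k = l"
  by (auto simp: letter_inv_def prod_eq_iff)

definition word_inv :: "letter list \<Rightarrow> letter list" where
  "word_inv ws = rev (map letter_inv ws)"

definition reduced :: "letter list \<Rightarrow> bool" where
  "reduced ws \<longleftrightarrow> successively (\<lambda>k l. l \<noteq> letter_inv k) ws"

lemma reduced_simps [simp]:
  "reduced []" "reduced [l]"
  "reduced (k # l # ws) \<longleftrightarrow> l \<noteq> letter_inv k \<and> reduced (l # ws)"
  by (auto simp: reduced_def)

lemma reduced_Cons:
  "reduced (l # ws) \<longleftrightarrow> reduced ws \<and> (ws \<noteq> [] \<longrightarrow> hd ws \<noteq> letter_inv l)"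
  by (cases ws) auto

lemma reduced_append:
  "reduced (us @ ws) \<longleftrightarrow> reduced us \<and> reduced ws \<and>
     (us \<noteq> [] \<and> ws \<noteq> [] \<longrightarrow> hd ws \<noteq> letter_inv (last us))"
  by (auto simp: reduced_def successively_append_iff)

lemma reduced_word_inv: "reduced ws \<Longrightarrow> reduced (word_inv ws)"
proof (induction ws)
  case Nil
  then show ?case by (simp add: word_inv_def)
next
  case (Cons l ws)
  have "hd ws \<noteq> letter_inv l \<Longrightarrow> letter_inv l \<noteq> letter_inv (letter_inv (hd ws))"
    by auto
  with Cons show ?case
    by (auto simp: word_inv_def reduced_append reduced_Cons last_rev hd_map)
qed

lemma word_inv_simps [simp]:
  "word_inv ws = [] \<longleftrightarrow> ws = []" "word_inv (l # ws) = word_inv ws @ [letter_inv l]"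
  "ws \<noteq> [] \<Longrightarrow> last (word_inv ws) = letter_inv (hd ws)"
  by (auto simp: word_inv_def last_rev hd_map)

section \<open>Orbits and decompositions under a free action\<close>

locale free_action =
  fixes f :: "letter \<Rightarrow> 'x \<Rightarrow> 'x" and X :: "'x set"
  assumes maps: "x \<in> X \<Longrightarrow> f l x \<in> X"
    and inv: "x \<in> X \<Longrightarrow> f (letter_inv l) (f l x) = x"
    and free: "x \<in> X \<Longrightarrow> reduced ws \<Longrightarrow> ws \<noteq> [] \<Longrightarrow> foldr f ws x \<noteq> x"
begin

text \<open>The free group itself is not constructed: its elements are represented by words, which
  act letter by letter, the last letter first.\<close>

abbreviation act :: "letter list \<Rightarrow> 'x \<Rightarrow> 'x" where "act \<equiv> foldr f"

lemma act_maps [simp]: "x \<in> X \<Longrightarrow> act ws x \<in> X"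
  by (induction ws) (auto intro: maps)

lemma inv' [simp]: "x \<in> X \<Longrightarrow> f l (f (letter_inv l) x) = x"
  using inv[of x "letter_inv l"] by simp

lemma act_word_inv: "x \<in> X \<Longrightarrow> act (word_inv ws) (act ws x) = x"
  by (induction ws arbitrary: x) (auto simp: inv word_inv_def)

text \<open>A new letter either cancels against the head of the reduced word found so far or extends
  it.\<close>

lemma reduce_word:
  assumes "x \<in> X"
  shows "\<exists>us. reduced us \<and> act us x = act ws x"
proof (induction ws)
  case Nil
  show ?case by (intro exI[of _ "[]"]) simp
next
  case (Cons l ws)
  then obtain us where us: "reduced us" "act us x = act ws x" by blast
  show ?case
  proof (cases "us \<noteq> [] \<and> hd us = letter_inv l")
    case True
    then obtain us' where [simp]: "us = letter_inv l # us'" by (cases us) auto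
    have "act us' x = act (l # ws) x"
      using us(2)[symmetric] assms by simp
    with us(1) show ?thesis by (auto simp: reduced_Cons)
  next
    case False
    with us show ?thesis by (intro exI[of _ "l # us"]) (auto simp: reduced_Cons)
  qed
qed

text \<open>Common first letters are stripped. Where the words differ, the inverse of one followed
  by the other is reduced, nonempty and fixes \<open>x\<close>, against \<open>free\<close>.\<close>

lemma act_inj:
  assumes "x \<in> X" "reduced us" "reduced ws" "act us x = act ws x"
  shows "us = ws"
  using assms(2-)
proof (induction us arbitrary: ws)
  case Nil
  then show ?case using free[OF assms(1) Nil(2)] by fastforce
next
  case (Cons l us)
  show ?case
  proof (cases "ws \<noteq> [] \<and> hd ws = l")
    case True
    then obtain ws' where [simp]: "ws = l # ws'" by (cases ws) auto
    have "act us x = act ws' x"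
      using arg_cong[OF Cons.prems(3), of "f (letter_inv l)"] assms(1) by (simp add: inv)
    with Cons show ?thesis by (auto simp: reduced_Cons)
  next
    case False
    have "reduced (word_inv (l # us) @ ws)"
      unfolding reduced_append
      using reduced_word_inv[OF Cons.prems(1)] Cons.prems(2) False by auto
    moreover have "act (word_inv (l # us) @ ws) x = x"
      using act_word_inv[OF assms(1), of "l # us"] Cons.prems(3)[symmetric] by simp
    ultimately show ?thesis using free[OF assms(1)] by fastforce
  qed
qed

text \<open>Every orbit gets a representative, taken from \<open>D\<close> if the orbit meets
  \<open>D\<close>; \<open>uniq\<close> then makes every point of \<open>D\<close> its own
  representative. By \<open>act_inj\<close> the word \<open>wd x\<close> serves as the coordinate of
  \<open>x\<close> within its orbit.\<close>

lemma orbit_partition: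
  assumes "D \<subseteq> X" and uniq: "\<And>x ws. x \<in> D \<Longrightarrow> act ws x \<in> D \<Longrightarrow> act ws x = x"
  obtains rep wd where
    "\<And>x. x \<in> X \<Longrightarrow> rep x \<in> X"
    "\<And>x. x \<in> X \<Longrightarrow> reduced (wd x)"
    "\<And>x. x \<in> X \<Longrightarrow> act (wd x) (rep x) = x"
    "\<And>x ws. x \<in> X \<Longrightarrow> rep (act ws x) = rep x"
    "\<And>x. x \<in> D \<Longrightarrow> rep x = x"
proof -
  define orb where "orb x = {act ws x | ws. True}" for x
  define rep where "rep x = (if orb x \<inter> D \<noteq> {} then SOME y. y \<in> orb x \<inter> D else SOME y. y \<in> orb x)" for x
  have self: "x \<in> orb x" for x
    unfolding orb_def by (auto intro: exI[of _ "[]"])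
  have rep_orb: "rep x \<in> orb x" and rep_D: "orb x \<inter> D \<noteq> {} \<Longrightarrow> rep x \<in> D" for x
    using someI_ex[of "\<lambda>y. y \<in> orb x \<inter> D"] someI[of "\<lambda>y. y \<in> orb x", OF self[of x]]
    unfolding rep_def by auto
  have sub: "orb (act ws x) \<subseteq> orb x" for ws x
  proof
    fix y assume "y \<in> orb (act ws x)"
    then obtain us where "y = act us (act ws x)" by (auto simp: orb_def)
    then have "y = act (us @ ws) x" by simp
    then show "y \<in> orb x" unfolding orb_def by blast
  qed
  have orb_eq: "orb (act ws x) = orb x" if "x \<in> X" for ws x
    using sub[of ws x] sub[of "word_inv ws" "act ws x"] act_word_inv[OF that] by auto
  have "\<exists>us. reduced us \<and> act us (rep x) = x" if "x \<in> X" for x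
  proof -
    obtain ws where "rep x = act ws x" using rep_orb[of x] by (auto simp: orb_def)
    then show ?thesis
      using reduce_word[of "rep x" "word_inv ws"] act_word_inv[OF that, of ws] that by auto
  qed
  then obtain wd where wd: "\<And>x. x \<in> X \<Longrightarrow> reduced (wd x) \<and> act (wd x) (rep x) = x" by metis
  have r1: "rep x \<in> X" if "x \<in> X" for x
    using rep_orb[of x] that by (auto simp: orb_def)
  have r2: "rep (act ws x) = rep x" if "x \<in> X" for x ws
    unfolding rep_def orb_eq[OF that] ..
  have r3: "rep x = x" if "x \<in> D" for x
  proof -
    have "rep x \<in> D" using rep_D self that by blast
    moreover obtain ws where "rep x = act ws x" using rep_orb[of x] by (auto simp: orb_def)
    ultimately show ?thesis using uniq[OF that] by auto
  qed
  show ?thesis using that[of rep wd] wd r1 r2 r3 by blast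
qed

text \<open>The classical decomposition by the first letter of \<open>wd x\<close>. Representatives
  have the empty word and hence no first letter: those in \<open>D\<close> are left out, the others
  are absorbed by the pieces of one generator. With \<open>D\<close> empty this is a paradox of
  \<open>X\<close> itself.\<close>

lemma free_paradox:
  assumes "D \<subseteq> X" and uniq: "\<And>x ws. x \<in> D \<Longrightarrow> act ws x \<in> D \<Longrightarrow> act ws x = x"
  obtains P1 P2 Q1 Q2 where
    "P1 \<union> P2 \<union> Q1 \<union> Q2 = X - D"
    "P1 \<inter> P2 = {}" "Q1 \<inter> Q2 = {}" "(P1 \<union> P2) \<inter> (Q1 \<union> Q2) = {}"
    "P1 \<union> f (False, False) ` P2 = X" "P1 \<inter> f (False, False) ` P2 = {}"
    "Q1 \<union> f (True, False) ` Q2 = X" "Q1 \<inter> f (True, False) ` Q2 = {}"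
proof -
  obtain rep wd where
    rep: "\<And>x. x \<in> X \<Longrightarrow> rep x \<in> X" and
    red: "\<And>x. x \<in> X \<Longrightarrow> reduced (wd x)" and
    wd: "\<And>x. x \<in> X \<Longrightarrow> act (wd x) (rep x) = x" and
    rep_act: "\<And>x ws. x \<in> X \<Longrightarrow> rep (act ws x) = rep x" and
    rep_D: "\<And>x. x \<in> D \<Longrightarrow> rep x = x"
    using orbit_partition[OF assms] by blast
  have rep_f: "rep (f l x) = rep x" if "x \<in> X" for l x
    using rep_act[OF that, of "[l]"] by simp
  have wd_f: "wd (f l x) = (if wd x \<noteq> [] \<and> hd (wd x) = letter_inv l then tl (wd x) else l # wd x)"
    (is "_ = ?w") if "x \<in> X" for l x
  proof -
    have "reduced ?w" using red[OF that] by (cases "wd x") (auto simp: reduced_Cons)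
    moreover have "act ?w (rep x) = f l x"
      using wd[OF that] rep[OF that] by (cases "wd x") (auto dest!: arg_cong[of _ x "f l"])
    moreover have "act (wd (f l x)) (rep x) = f l x" using wd[of "f l x"] rep_f that maps by auto
    ultimately show ?thesis
      using act_inj[OF rep[OF that], of "wd (f l x)" ?w] red[of "f l x"] that maps by auto
  qed
  have wd_Nil: "wd x = [] \<longleftrightarrow> rep x = x" if "x \<in> X" for x
    using wd[OF that] free[OF rep[OF that] red[OF that]] by (metis foldr.simps(1) id_apply)
  define W where "W l = {x \<in> X. wd x \<noteq> [] \<and> hd (wd x) = l}" for l
  \<comment> \<open>Absorbs the representatives outside \<open>D\<close>: \<open>f (False, False)\<close> maps
    \<open>S - {rep x}\<close> onto \<open>S\<close> within each such orbit.\<close>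
  define S where "S = {x \<in> X. rep x \<notin> D \<and> set (wd x) \<subseteq> {(False, True)}}"
  \<comment> \<open>The letter \<open>l\<close> cancels the head of such a word, and by reducedness
    the rest does not start with \<open>l\<close>. Conversely, any word that does not start with
    \<open>l\<close> arises in this way.\<close>
  have fW: "f l ` W (letter_inv l) = X - W l" for l
  proof safe
    fix x assume "x \<in> W (letter_inv l)"
    then show "f l x \<in> X" by (simp add: W_def maps)
    assume *: "f l x \<in> W l"
    from \<open>x \<in> W (letter_inv l)\<close> have x: "x \<in> X" "wd x \<noteq> []" "hd (wd x) = letter_inv l"
      by (auto simp: W_def)
    then show False using * red[OF x(1)] unfolding W_def
      by (cases "wd x") (auto simp: wd_f reduced_Cons)
  next
    fix x assume x: "x \<in> X" "x \<notin> W l"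
    then have "f (letter_inv l) x \<in> W (letter_inv l)"
      by (auto simp: W_def wd_f maps)
    then show "x \<in> f l ` W (letter_inv l)"
      using inv'[OF x(1), of l] by (metis imageI)
  qed
  \<comment> \<open>Removing a leading \<open>(False, True)\<close> does not change whether all
    letters of the word are \<open>(False, True)\<close>.\<close>
  have S_f: "f (False, False) x \<in> S \<longleftrightarrow> x \<in> S" if "x \<in> W (False, True)" for x
  proof -
    from that have x: "x \<in> X" "wd x \<noteq> []" "hd (wd x) = (False, True)" by (auto simp: W_def)
    then show ?thesis
      by (cases "wd x") (auto simp: S_def wd_f rep_f maps)
  qed
  have S_W: "S \<inter> W l \<noteq> {} \<Longrightarrow> l = (False, True)" for l
    unfolding S_def W_def using hd_in_set by fastforce
  have fS: "f (False, False) ` (W (False, True) - S) = X - W (False, False) - S"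
    (is "?L = ?R")
  proof
    show "?L \<subseteq> ?R"
      using fW[of "(False, False)"] S_f by auto
    show "?R \<subseteq> ?L"
    proof
      fix x assume "x \<in> ?R"
      then have "x \<in> f (False, False) ` W (False, True)" "x \<notin> S"
        using fW[of "(False, False)"] by auto
      then obtain y where "y \<in> W (False, True)" "x = f (False, False) y" "x \<notin> S"
        by blast
      then show "x \<in> ?L" using S_f by auto
    qed
  qed
  have cover: "x \<in> W (False, False) \<union> W (False, True) \<union> W (True, False) \<union> W (True, True)"
    if "x \<in> X" "wd x \<noteq> []" for x
    using that by (auto simp: W_def prod_eq_iff)
  have disj: "W k \<inter> W l = {}" if "k \<noteq> l" for k l
    using that by (auto simp: W_def)
  have WD: "W l \<inter> D = {}" for l
    using wd_Nil rep_D \<open>D \<subseteq> X\<close> by (auto simp: W_def)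
  have SD: "S \<inter> D = {}"
    using rep_D by (auto simp: S_def)
  have SX: "S \<subseteq> X" and WX: "W l \<subseteq> X" for l by (auto simp: S_def W_def)
  have nilS: "x \<in> S" if "x \<in> X" "wd x = []" "x \<notin> D" for x
    using that wd_Nil[OF that(1)] by (auto simp: S_def)
  show ?thesis
  proof (rule that[of "W (False, False) \<union> S" "W (False, True) - S" "W (True, False)" "W (True, True)"])
    show "W (False, False) \<union> S \<union> (W (False, True) - S) \<union> W (True, False) \<union> W (True, True) = X - D"
      using cover nilS WD SD SX WX by blast
    show "(W (False, False) \<union> S) \<inter> (W (False, True) - S) = {}"
      using disj by blast
    show "W (True, False) \<inter> W (True, True) = {}" by (rule disj) simp
    show "(W (False, False) \<union> S \<union> (W (False, True) - S)) \<inter> (W (True, False) \<union> W (True, True)) = {}"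
      using disj[of "(False, False)" "(True, False)"] disj[of "(False, False)" "(True, True)"]
       disj[of "(False, True)" "(True, False)"] disj[of "(False, True)" "(True, True)"]
       S_W[of "(True, False)"] S_W[of "(True, True)"] by auto
    show "W (False, False) \<union> S \<union> f (False, False) ` (W (False, True) - S) = X"
         "(W (False, False) \<union> S) \<inter> f (False, False) ` (W (False, True) - S) = {}"
      unfolding fS using SX WX by auto
    show "W (True, False) \<union> f (True, False) ` W (True, True) = X"
         "W (True, False) \<inter> f (True, False) ` W (True, True) = {}"
      using fW[of "(True, False)"] WX[of "(True, False)"] by auto
  qed
qed

end

section \<open>A free group of matrices without eigenvalue 1\<close>

definition upper_mat :: "'a::comm_ring_1 \<Rightarrow> 'a^2^2" where
  "upper_mat c = vector [vector [1, c], vector [0, 1]]"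

definition lower_mat :: "'a::comm_ring_1 \<Rightarrow> 'a^2^2" where
  "lower_mat d = vector [vector [1, 0], vector [d, 1]]"

lemma upper_mat_nth [simp]:
  "upper_mat c $ 1 $ 1 = 1" "upper_mat c $ 1 $ 2 = c" "upper_mat c $ 2 $ 1 = 0" "upper_mat c $ 2 $ 2 = 1"
  by (simp_all add: upper_mat_def)

lemma lower_mat_nth [simp]:
  "lower_mat c $ 1 $ 1 = 1" "lower_mat c $ 1 $ 2 = 0" "lower_mat c $ 2 $ 1 = c" "lower_mat c $ 2 $ 2 = 1"
  by (simp_all add: lower_mat_def)

lemma mat2_eq_iff:
  "(A :: 'a^2^2) = B \<longleftrightarrow> A $ 1 $ 1 = B $ 1 $ 1 \<and> A $ 1 $ 2 = B $ 1 $ 2 \<and>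
      A $ 2 $ 1 = B $ 2 $ 1 \<and> A $ 2 $ 2 = B $ 2 $ 2"
  unfolding vec_eq_iff forall_2 by blast

lemma mat2_mult: "((A :: 'a::semiring_1^2^2) ** B) $ i $ j = A $ i $ 1 * B $ 1 $ j + A $ i $ 2 * B $ 2 $ j"
  by (simp add: matrix_matrix_mult_def sum_2)

lemma upper_mat_add: "upper_mat b ** upper_mat c = upper_mat (b + c)"
  and lower_mat_add: "lower_mat b ** lower_mat c = lower_mat (b + c)"
  and upper_mat_0 [simp]: "upper_mat 0 = mat 1"
  and lower_mat_0 [simp]: "lower_mat 0 = mat 1"
  by (auto simp: mat2_eq_iff mat2_mult mat_def)

lemma det_upper_mat [simp]: "det (upper_mat c) = 1" and det_lower_mat [simp]: "det (lower_mat c) = 1"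
  by (simp_all add: det_2)

text \<open>For determinant 1, \<open>2 - trace A\<close> equals \<open>det (A - mat 1)\<close>, and
  \<open>A - mat 1\<close> is singular.\<close>

lemma trace_eq_2_if_fixed:
  fixes A :: "'a::field^2^2"
  assumes "det A = 1" "A *v x = x" "x \<noteq> 0"
  shows "trace A = 2"
proof -
  let ?a = "A $ 1 $ 1" and ?b = "A $ 1 $ 2" and ?c = "A $ 2 $ 1" and ?d = "A $ 2 $ 2"
  have "?a * x $ 1 + ?b * x $ 2 = x $ 1" "?c * x $ 1 + ?d * x $ 2 = x $ 2"
    using assms(2) by (simp_all add: vec_eq_iff matrix_vector_mult_def sum_2 forall_2)
  then have e: "(?a - 1) * x $ 1 = - (?b * x $ 2)" "(?d - 1) * x $ 2 = - (?c * x $ 1)"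
    by (simp_all add: algebra_simps eq_neg_iff_add_eq_0)
  have "?a * ?d - ?b * ?c = 1" using assms(1) by (simp add: det_2)
  then have d: "2 - (?a + ?d) = (?a - 1) * (?d - 1) - ?b * ?c" by (simp add: algebra_simps)
  \<comment> \<open>Cramer's rule: applying the adjugate of \<open>A - mat 1\<close> to
    \<open>(A - mat 1) *v x = 0\<close> shows that the determinant annihilates each coordinate of
    \<open>x\<close>.\<close>
  have "(2 - (?a + ?d)) * x $ 1 = (?d - 1) * ((?a - 1) * x $ 1) - ?b * (?c * x $ 1)"
    unfolding d by (simp add: algebra_simps)
  also have "\<dots> = - ?b * ((?d - 1) * x $ 2) - ?b * (?c * x $ 1)"
    unfolding e(1) by (simp add: algebra_simps)
  also have "\<dots> = 0" unfolding e(2) by simp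
  finally have 1: "(2 - (?a + ?d)) * x $ 1 = 0" .
  have "(2 - (?a + ?d)) * x $ 2 = (?a - 1) * ((?d - 1) * x $ 2) - ?c * (?b * x $ 2)"
    unfolding d by (simp add: algebra_simps)
  also have "\<dots> = - ?c * ((?a - 1) * x $ 1) - ?c * (?b * x $ 2)"
    unfolding e(2) by (simp add: algebra_simps)
  also have "\<dots> = 0" unfolding e(1) by simp
  finally have 2: "(2 - (?a + ?d)) * x $ 2 = 0" .
  have "x $ 1 \<noteq> 0 \<or> x $ 2 \<noteq> 0" using assms(3) by (simp add: vec_eq_iff forall_2)
  then show ?thesis using 1 2 by (auto simp: trace_def sum_2)
qed

section \<open>Growth of matrix entries under an absolute value\<close>

locale absolute_subring =
  fixes R0 :: "'a::field set" and w :: "'a \<Rightarrow> real"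
  assumes one_mem [simp]: "1 \<in> R0"
    and add_mem [simp]: "x \<in> R0 \<Longrightarrow> y \<in> R0 \<Longrightarrow> x + y \<in> R0"
    and mult_mem [simp]: "x \<in> R0 \<Longrightarrow> y \<in> R0 \<Longrightarrow> x * y \<in> R0"
    and minus_mem [simp]: "x \<in> R0 \<Longrightarrow> - x \<in> R0"
    and w_zero [simp]: "w 0 = 0" and w_one [simp]: "w 1 = 1"
    and w_triangle: "x \<in> R0 \<Longrightarrow> y \<in> R0 \<Longrightarrow> w (x + y) \<le> w x + w y"
    and w_mult: "x \<in> R0 \<Longrightarrow> y \<in> R0 \<Longrightarrow> w (x * y) = w x * w y"
    and w_minus [simp]: "x \<in> R0 \<Longrightarrow> w (- x) = w x"
begin

lemma zero_mem [simp]: "0 \<in> R0"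
  using add_mem[OF one_mem minus_mem[OF one_mem]] by simp

lemma diff_mem [simp]: "x \<in> R0 \<Longrightarrow> y \<in> R0 \<Longrightarrow> x - y \<in> R0"
  using add_mem[of x "- y"] by simp

lemma w_diff_ge: "x \<in> R0 \<Longrightarrow> y \<in> R0 \<Longrightarrow> w x - w y \<le> w (x + y)"
  using w_triangle[of "x + y" "- y"] by simp

lemma w_nonneg: "x \<in> R0 \<Longrightarrow> 0 \<le> w x"
  using w_triangle[of x "- x"] by simp

lemma w_two_le: "w 2 \<le> 2"
  using w_triangle[of 1 1] by simp

abbreviation big :: "'a \<Rightarrow> bool" where "big c \<equiv> c \<in> R0 \<and> 4 \<le> w c"

fun lu_prod :: "('a \<times> 'a) list \<Rightarrow> 'a^2^2" where
  "lu_prod [] = mat 1"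
| "lu_prod ((d, c) # cs) = (lower_mat d ** upper_mat c) ** lu_prod cs"

lemma lu_prod_append: "lu_prod (xs @ ys) = lu_prod xs ** lu_prod ys"
  by (induction xs rule: lu_prod.induct) (auto simp: matrix_mul_assoc)

lemma lu_prod_mem: "list_all (\<lambda>(d, c). big d \<and> big c) cs \<Longrightarrow> lu_prod cs $ i $ j \<in> R0"
proof (induction cs arbitrary: i rule: lu_prod.induct)
  case (2 d c cs)
  then have "lu_prod cs $ 1 $ j \<in> R0" "lu_prod cs $ 2 $ j \<in> R0"
    by simp_all
  with 2 show ?case using exhaust_2[of i] by (auto simp: mat2_mult)
qed (auto simp: mat_def)

text \<open>The term \<open>y * (c * d)\<close> outweighs everything else in the new second entry,
  so the second entry keeps dominating the first and grows at least sixfold. Rows use this as it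
  stands, columns with \<open>c\<close> and \<open>d\<close> interchanged.\<close>

lemma big_step:
  assumes "big d" "big c" "x \<in> R0" "y \<in> R0" "2 * w x \<le> w y"
  shows "2 * w (x + y * d) \<le> w (x * c + y * (1 + c * d))"
    and "6 * w y \<le> w (x * c + y * (1 + c * d))"
proof -
  have nn: "0 \<le> w y" "0 \<le> w c" "0 \<le> w d" "0 \<le> w x" using assms by (auto intro: w_nonneg)
  have a: "w (x + y * d) \<le> w x + w y * w d"
    using w_triangle[of x "y * d"] assms by (simp add: w_mult)
  have b: "w y * (w c * w d) - w y - w x * w c \<le> w (x * c + y * (1 + c * d))"
  proof -
    have eq: "x * c + y * (1 + c * d) = y * (c * d) + (y + x * c)" by (simp add: algebra_simps)
    have "w (y + x * c) \<le> w y + w x * w c"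
      using w_triangle[of y "x * c"] assms by (simp add: w_mult)
    moreover have "w (y * (c * d)) = w y * (w c * w d)" using assms by (simp add: w_mult)
    moreover have "w (y * (c * d)) - w (y + x * c) \<le> w (y * (c * d) + (y + x * c))"
      using assms by (intro w_diff_ge) simp_all
    ultimately show ?thesis unfolding eq by linarith
  qed
  have xc: "2 * (w x * w c) \<le> w y * w c"
    using mult_right_mono[OF assms(5) nn(2)] by simp
  \<comment> \<open>This bounds the product \<open>w c * w d\<close> below by a linear expression,
    which makes both estimates linear.\<close>
  have "0 \<le> (w c - 4) * (w d - 4)" using assms by simp
  then have cd: "w c * w d \<ge> 4 * w c + 4 * w d - 16" by (simp add: algebra_simps)
  have "2 + w c / 2 + 2 * w d \<le> w c * w d" using cd assms by linarith
  then have 1: "w y * (2 + w c / 2 + 2 * w d) \<le> w y * (w c * w d)" using nn(1) by (rule mult_left_mono)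
  show "2 * w (x + y * d) \<le> w (x * c + y * (1 + c * d))"
    using a b 1 xc assms(5) by (simp add: algebra_simps)
  have "7 + w c / 2 \<le> w c * w d" using cd assms by linarith
  then have 2: "w y * (7 + w c / 2) \<le> w y * (w c * w d)" using nn(1) by (rule mult_left_mono)
  show "6 * w y \<le> w (x * c + y * (1 + c * d))"
    using b 2 xc by (simp add: algebra_simps)
qed

lemma lu_prod_Cons_nth:
  "lu_prod ((d, c) # cs) $ 1 $ j = lu_prod cs $ 1 $ j + lu_prod cs $ 2 $ j * c"
  "lu_prod ((d, c) # cs) $ 2 $ j = lu_prod cs $ 1 $ j * d + lu_prod cs $ 2 $ j * (1 + d * c)"
  by (simp_all add: mat2_mult algebra_simps)

lemma lu_prod_snoc_nth:
  "lu_prod (cs @ [(d, c)]) $ i $ 1 = lu_prod cs $ i $ 1 + lu_prod cs $ i $ 2 * d"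
  "lu_prod (cs @ [(d, c)]) $ i $ 2 = lu_prod cs $ i $ 1 * c + lu_prod cs $ i $ 2 * (1 + c * d)"
  by (simp_all add: lu_prod_append mat2_mult algebra_simps)

text \<open>A factor on the left acts on columns, so \<open>big_step\<close> is applied to the
  second column, starting from (0, 1).\<close>

lemma lu_prod_column:
  assumes "list_all (\<lambda>(d, c). big d \<and> big c) cs"
  shows "2 * w (lu_prod cs $ 1 $ 2) \<le> w (lu_prod cs $ 2 $ 2) \<and> 6 ^ length cs \<le> w (lu_prod cs $ 2 $ 2)"
  using assms
proof (induction cs rule: lu_prod.induct)
  case (2 d c cs)
  then have *: "list_all (\<lambda>(d, c). big d \<and> big c) cs" "big d" "big c"
    and le: "2 * w (lu_prod cs $ 1 $ 2) \<le> w (lu_prod cs $ 2 $ 2)" "6 ^ length cs \<le> w (lu_prod cs $ 2 $ 2)"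
    by auto
  note step = big_step[OF *(3,2) lu_prod_mem[OF *(1), of 1 2] lu_prod_mem[OF *(1), of 2 2] le(1)]
  show ?case
    unfolding lu_prod_Cons_nth using step le(2) by simp
qed (auto simp: mat_def)

text \<open>A factor on the right acts on rows, hence the induction from the end. The empty product
  is excluded because its first row is (1, 0).\<close>

lemma lu_prod_row:
  assumes "list_all (\<lambda>(d, c). big d \<and> big c) cs" "cs \<noteq> []"
  shows "2 * w (lu_prod cs $ 1 $ 1) \<le> w (lu_prod cs $ 1 $ 2)"
  using assms
proof (induction cs rule: rev_induct)
  case (snoc x cs)
  obtain d c where [simp]: "x = (d, c)" by (cases x)
  from snoc have *: "list_all (\<lambda>(d, c). big d \<and> big c) cs" "big d" "big c" by auto
  show ?case
  proof (cases "cs = []")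
    case True
    then show ?thesis using * by (simp add: mat2_mult)
  next
    case False
    note step = big_step[OF *(2,3) lu_prod_mem[OF *(1), of 1 1] lu_prod_mem[OF *(1), of 1 2]
        snoc.IH[OF *(1) False]]
    show ?thesis
      using step(1) by (simp add: lu_prod_snoc_nth)
  qed
qed simp

text \<open>Measured by \<open>w\<close>, the top left entry is at most a quarter of the bottom
  right one, which is at least 6. So the trace exceeds 2, whereas
  \<open>w 2 \<le> 2\<close>.\<close>

lemma trace_lu_prod:
  assumes "list_all (\<lambda>(d, c). big d \<and> big c) cs" "cs \<noteq> []"
  shows "trace (lu_prod cs) \<noteq> 2"
proof -
  let ?P = "lu_prod cs"
  have "(6::real) ^ 1 \<le> 6 ^ length cs"
    using assms(2) by (intro power_increasing) (auto simp: Suc_le_eq)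
  moreover note lu_prod_column[OF assms(1)] lu_prod_row[OF assms]
  moreover have "w (?P $ 2 $ 2) - w (?P $ 1 $ 1) \<le> w (trace ?P)"
    using w_diff_ge[of "?P $ 2 $ 2" "?P $ 1 $ 1"] lu_prod_mem[OF assms(1)]
    by (simp add: trace_def sum_2 add.commute)
  ultimately have "2 < w (trace ?P)" by simp
  then show ?thesis using w_two_le by auto
qed

end

text \<open>In the product along a reduced word, the upper factors that meet between the letters \<open>l\<close>
  and \<open>k\<close> merge to \<open>upper_mat (e k - e (letter_inv l))\<close>. Hence nothing cancels as soon as
  the values of \<open>e\<close> are far apart.\<close>

definition letter_mat :: "(letter \<Rightarrow> 'a::field) \<Rightarrow> (letter \<Rightarrow> 'a) \<Rightarrow> letter \<Rightarrow> 'a^2^2" where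
  "letter_mat e d l = upper_mat (e l) ** lower_mat (d l) ** upper_mat (- e (letter_inv l))"

abbreviation word_mat :: "(letter \<Rightarrow> 'a::field) \<Rightarrow> (letter \<Rightarrow> 'a) \<Rightarrow> letter list \<Rightarrow> 'a^2^2" where
  "word_mat e d ws \<equiv> foldr (\<lambda>l A. letter_mat e d l ** A) ws (mat 1)"

lemma det_letter_mat [simp]: "det (letter_mat e d l) = 1"
  by (simp add: letter_mat_def det_mul)

lemma det_word_mat [simp]: "det (word_mat e d ws) = 1"
  by (induction ws) (simp_all add: det_mul)

lemma word_mat_append: "word_mat e d (us @ ws) = word_mat e d us ** word_mat e d ws"
  by (induction us) (simp_all add: matrix_mul_assoc)

text \<open>The product telescopes: the two inner upper factors cancel, then the lower ones, then
  the outer upper ones.\<close>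

lemma letter_mat_inv:
  assumes "\<And>l. d (letter_inv l) = - d l"
  shows "letter_mat e d (letter_inv l) ** letter_mat e d l = mat 1"
proof -
  have u: "upper_mat (- e l) ** (upper_mat (e l) ** A) = A"
          "lower_mat (- d l) ** (lower_mat (d l) ** A) = A"
          "upper_mat (e (letter_inv l)) ** upper_mat (- e (letter_inv l)) = mat 1" for A
    by (simp_all add: matrix_mul_assoc upper_mat_add lower_mat_add)
  show ?thesis
    by (simp add: letter_mat_def assms matrix_mul_assoc[symmetric] u)
qed

context absolute_subring
begin

text \<open>The first upper factor is split off on the left, and \<open>upper_mat y\<close> merges
  with the last one. For \<open>y = e (hd ws)\<close> this says that the word is conjugate to
  \<open>lu_prod cs\<close>.\<close>

lemma word_mat_conv_lu_prod:
  assumes d: "\<And>l. big (d l)" and e: "\<And>k l. k \<noteq> l \<Longrightarrow> big (e k - e l)"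
    and "reduced ws" "ws \<noteq> []" "big (y - e (letter_inv (last ws)))"
  obtains cs where "list_all (\<lambda>(d, c). big d \<and> big c) cs" "cs \<noteq> []"
    "word_mat e d ws ** upper_mat y = upper_mat (e (hd ws)) ** lu_prod cs"
  using assms(3-)
proof (induction ws arbitrary: thesis)
  case (Cons l ws)
  show ?case
  proof (cases "ws = []")
    case True
    show ?thesis
      using Cons.prems True d
      by (intro Cons.prems(1)[of "[(d l, y - e (letter_inv l))]"])
         (auto simp: letter_mat_def matrix_mul_assoc[symmetric] upper_mat_add)
  next
    case False
    with Cons.prems(2-) have "reduced ws" "big (y - e (letter_inv (last ws)))"
      and hd: "hd ws \<noteq> letter_inv l" by (auto simp: reduced_Cons)
    with Cons.IH False obtain cs where cs: "list_all (\<lambda>(d, c). big d \<and> big c) cs" "cs \<noteq> []"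
      "word_mat e d ws ** upper_mat y = upper_mat (e (hd ws)) ** lu_prod cs" by blast
    have "word_mat e d (l # ws) ** upper_mat y = letter_mat e d l ** (upper_mat (e (hd ws)) ** lu_prod cs)"
      using cs(3) by (simp add: matrix_mul_assoc[symmetric])
    also have "\<dots> = upper_mat (e l) ** (lower_mat (d l) ** (
        (upper_mat (- e (letter_inv l)) ** upper_mat (e (hd ws))) ** lu_prod cs))"
      by (simp add: letter_mat_def matrix_mul_assoc)
    also have "\<dots> = upper_mat (e l) ** lu_prod ((d l, e (hd ws) - e (letter_inv l)) # cs)"
      by (simp add: upper_mat_add matrix_mul_assoc)
    finally show ?thesis
      using cs(1) d e[OF hd]
      by (intro Cons.prems(1)[of "(d l, e (hd ws) - e (letter_inv l)) # cs"]) auto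
  qed
qed simp

text \<open>A word that starts with a letter and ends with its inverse is conjugate to a shorter
  word, whose fixed vector is the translated one. All other words are conjugate to some
  \<open>lu_prod cs\<close>, whose trace is not 2.\<close>

lemma word_mat_no_fixed_vector:
  assumes d: "\<And>l. big (d l)" and e: "\<And>k l. k \<noteq> l \<Longrightarrow> big (e k - e l)"
    and d_inv: "\<And>l. d (letter_inv l) = - d l"
    and "reduced ws" "ws \<noteq> []" "x \<noteq> 0"
  shows "word_mat e d ws *v x \<noteq> x"
  using assms(4-)
proof (induction ws arbitrary: x rule: length_induct)
  case (1 ws)
  let ?M = "letter_mat e d"
  show ?case
  proof (cases "last ws = letter_inv (hd ws)")
    case True
    obtain l us where us: "ws = l # us" using 1(3) by (cases ws) auto
    have "us \<noteq> []" using True us by auto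
    then obtain vs k where vs: "us = vs @ [k]" by (metis rev_exhaust)
    have ws: "ws = l # vs @ [letter_inv l]" using us vs True by auto
    \<comment> \<open>Otherwise \<open>ws\<close> would be \<open>[l, letter_inv l]\<close>, which
      is not reduced.\<close>
    have "vs \<noteq> []" using 1(2) by (auto simp: ws)
    have "reduced vs" using 1(2) by (auto simp: ws reduced_Cons reduced_append)
    show ?thesis
    proof
      assume *: "word_mat e d ws *v x = x"
      let ?y = "?M (letter_inv l) *v x"
      have inv: "?M (letter_inv l) *v (?M l *v z) = z" "?M l *v (?M (letter_inv l) *v z) = z" for z
        using letter_mat_inv[of d e l] letter_mat_inv[of d e "letter_inv l"] d_inv
        by (simp_all add: matrix_vector_mul_assoc)
      have "?y \<noteq> 0" using inv(2)[of x] 1(4) by (metis matrix_vector_mult_0_right)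
      moreover have "word_mat e d vs *v ?y = ?y"
      proof -
        have "?M l *v (word_mat e d vs *v ?y) = x"
          using * by (simp add: ws word_mat_append matrix_vector_mul_assoc matrix_mul_assoc del: foldr_append)
        then show ?thesis using inv(1) by metis
      qed
      ultimately show False
        using 1(1) \<open>vs \<noteq> []\<close> \<open>reduced vs\<close> ws by auto
    qed
  next
    case False
    let ?u = "e (hd ws)"
    \<comment> \<open>The word is cyclically reduced, so the upper factors at its two ends also
      merge to a big one.\<close>
    have ne: "hd ws \<noteq> letter_inv (last ws)" using False by auto
    obtain cs where cs: "list_all (\<lambda>(d, c). big d \<and> big c) cs" "cs \<noteq> []"
      "word_mat e d ws ** upper_mat ?u = upper_mat ?u ** lu_prod cs"
      by (rule word_mat_conv_lu_prod[where d = d and e = e and y = ?u, OF d e 1(2,3) e[OF ne]])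
    have "trace (word_mat e d ws) = trace (word_mat e d ws ** (upper_mat ?u ** upper_mat (- ?u)))"
      by (simp add: upper_mat_add)
    also have "\<dots> = trace ((upper_mat ?u ** lu_prod cs) ** upper_mat (- ?u))"
      using cs(3) by (simp add: matrix_mul_assoc)
    also have "\<dots> = trace (upper_mat (- ?u) ** (upper_mat ?u ** lu_prod cs))"
      by (rule trace_mul_sym)
    also have "\<dots> = trace (lu_prod cs)"
      by (simp add: matrix_mul_assoc upper_mat_add)
    finally have "trace (word_mat e d ws) \<noteq> 2" using trace_lu_prod[OF cs(1,2)] by simp
    then show ?thesis
      using trace_eq_2_if_fixed[OF det_word_mat _ 1(4)] by blast
  qed
qed

end

section \<open>Congruence subgroups\<close>

definition transvection :: "'n set \<Rightarrow> ('n \<Rightarrow> 'n) \<Rightarrow> 'a::comm_ring_1 \<Rightarrow> 'a^'n^'n::finite" where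
  "transvection S \<tau> c = (\<chi> i j. (if i = j then 1 else 0) + (if i \<in> S \<and> j = \<tau> i then c else 0))"

lemma transvection_mult_nth:
  "(transvection S \<tau> c *v x) $ i = x $ i + (if i \<in> S then c * x $ \<tau> i else 0)"
  by (simp add: transvection_def matrix_vector_mult_def distrib_right sum.distrib
      if_distrib[of "\<lambda>a. a * _"] cong: if_cong)

text \<open>Each index \<open>i\<close> in \<open>S\<close> contributes one row operation. As
  \<open>\<tau> i\<close> lies outside \<open>S\<close>, the row that is added is still a unit
  vector.\<close>

lemma det_transvection:
  assumes "\<tau> ` S \<inter> S = {}"
  shows "det (transvection S \<tau> c) = 1"
proof -
  have "finite S" by simp
  then show ?thesis using assms
  proof (induction S rule: finite_induct)
    case empty
    have "transvection {} \<tau> c = mat 1" by (simp add: transvection_def mat_def vec_eq_iff)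
    then show ?case by simp
  next
    case (insert i S)
    let ?A = "transvection S \<tau> c"
    have "\<tau> i \<noteq> i" "\<tau> i \<notin> S" using insert.prems by auto
    have "transvection (insert i S) \<tau> c = (\<chi> k. if k = i then row i ?A + c *s row (\<tau> i) ?A else row k ?A)"
      using insert.hyps \<open>\<tau> i \<noteq> i\<close> \<open>\<tau> i \<notin> S\<close>
      by (auto simp: transvection_def row_def vec_eq_iff)
    then have "det (transvection (insert i S) \<tau> c) = det ?A"
      using det_row_operation[of i "\<tau> i" ?A c] \<open>\<tau> i \<noteq> i\<close> by simp
    then show ?case using insert by auto
  qed
qed

lemma transvection_inverse:
  assumes "\<tau> ` S \<inter> S = {}" "b + c = 0"
  shows "transvection S \<tau> b ** transvection S \<tau> c = mat 1"
proof -
  have "b = - c" using assms(2) by (simp add: eq_neg_iff_add_eq_0)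
  then show ?thesis
    using assms(1)
    by (auto simp: matrix_eq vec_eq_iff matrix_vector_mul_assoc[symmetric] transvection_mult_nth)
qed

section \<open>Estimates for the valuation and the maximum norm\<close>

locale nonarch =
  fixes v :: "'a::field \<Rightarrow> real"
  assumes nonarch: "nonarch_valuation v"
begin

lemma v_nonneg [simp]: "0 \<le> v x" and v_eq_0_iff [simp]: "v x = 0 \<longleftrightarrow> x = 0"
  and v_mult: "v (x * y) = v x * v y" and v_add: "v (x + y) \<le> max (v x) (v y)"
  using nonarch by (auto simp: nonarch_valuation_def)

lemma v_one [simp]: "v 1 = 1"
  using v_mult[of 1 1] v_eq_0_iff[of 1] by auto

lemma v_zero [simp]: "v 0 = 0"
  by simp

lemma v_power: "v (x ^ k) = v x ^ k"
  by (induction k) (auto simp: v_mult)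

lemma v_minus [simp]: "v (- x) = v x"
proof -
  have "(v (-1))\<^sup>2 = 1" using v_mult[of "-1" "-1"] by (simp add: power2_eq_square)
  then have "v (-1) = 1" using v_nonneg[of "-1"] by (simp add: power2_eq_1_iff)
  then show ?thesis using v_mult[of "-1" x] by simp
qed

lemma v_sum_less:
  assumes "0 < \<epsilon>" "\<And>k. k \<in> A \<Longrightarrow> v (f k) < \<epsilon>"
  shows "v (sum f A) < \<epsilon>"
  using assms(2)
proof (induction A rule: infinite_finite_induct)
  case (insert a A)
  then show ?case using v_add[of "f a" "sum f A"] by fastforce
qed (use assms(1) in auto)

lemma v_sum_le:
  assumes "0 \<le> c" "\<And>k. k \<in> A \<Longrightarrow> v (f k) \<le> c"
  shows "v (sum f A) \<le> c"
  using assms(2)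
proof (induction A rule: infinite_finite_induct)
  case (insert a A)
  then show ?case using v_add[of "f a" "sum f A"] by fastforce
qed (use assms(1) in auto)

lemma max_norm_le:
  assumes "\<And>i j. v (A $ i $ j) \<le> 1"
  shows "max_norm v (A *v x) \<le> max_norm v x"
proof -
  have "v ((A *v x) $ i) \<le> max_norm v x" for i
    unfolding matrix_vector_mult_def vec_lambda_beta
  proof (rule v_sum_le)
    have le: "v (x $ j) \<le> max_norm v x" for j
      unfolding max_norm_def by (rule Max_ge) auto
    from order.trans[OF v_nonneg le] show "0 \<le> max_norm v x" .
    show "v (A $ i $ j * x $ j) \<le> max_norm v x" for j
      using mult_mono[OF assms le, of j i j] by (simp add: v_mult)
  qed
  then show ?thesis unfolding max_norm_def[of v "A *v x"] by (subst Max_le_iff) auto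
qed

end

text \<open>Collects what the two cases of \<open>coefficient_ring v\<close> have in common.\<close>

locale coefficients = nonarch v for v :: "'a::field \<Rightarrow> real" +
  fixes R :: "'a set" and \<epsilon> :: real
  assumes eps: "0 < \<epsilon>" "\<epsilon> \<le> 1"
    and one_in [simp]: "1 \<in> R"
    and add_in [simp]: "x \<in> R \<Longrightarrow> y \<in> R \<Longrightarrow> x + y \<in> R"
    and mult_in [simp]: "x \<in> R \<Longrightarrow> y \<in> R \<Longrightarrow> x * y \<in> R"
    and minus_in [simp]: "x \<in> R \<Longrightarrow> - x \<in> R"
    and v_le_1: "x \<in> R \<Longrightarrow> v x \<le> 1"
begin

lemma zero_in [simp]: "0 \<in> R"
  using add_in[OF one_in minus_in[OF one_in]] by simp

lemma sum_in: "(\<And>i. i \<in> A \<Longrightarrow> f i \<in> R) \<Longrightarrow> sum f A \<in> R"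
  by (induction A rule: infinite_finite_induct) auto

lemma SL_group_carrier:
  "A \<in> carrier (SL_group v R \<epsilon>) \<longleftrightarrow>
     (\<forall>i j. A $ i $ j \<in> R) \<and> det A = 1 \<and> (\<forall>i j. v ((A - mat 1) $ i $ j) < \<epsilon>)"
  unfolding SL_group_def mat_def by (auto split: if_splits)

lemma SL_group_entry_le: "A \<in> carrier (SL_group v R \<epsilon>) \<Longrightarrow> v (A $ i $ j) \<le> 1"
  by (auto simp: SL_group_def v_le_1)

lemma one_in_SL_group: "mat 1 \<in> carrier (SL_group v R \<epsilon>)"
  using eps det_I by (auto simp: SL_group_carrier mat_def)

lemma mult_in_SL_group:
  assumes "A \<in> carrier (SL_group v R \<epsilon>)" "B \<in> carrier (SL_group v R \<epsilon>)"
  shows "A ** B \<in> carrier (SL_group v R \<epsilon>)"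
proof -
  have "v ((A ** B - mat 1) $ i $ j) < \<epsilon>" for i j
  proof -
    \<comment> \<open>Both summands have entries below \<open>\<epsilon>\<close>, the first one
      because the entries of \<open>B\<close> have value at most 1.\<close>
    have "A ** B - mat 1 = (A - mat 1) ** B + (B - mat 1)"
      by (simp add: matrix_eq matrix_vector_mult_diff_rdistrib matrix_vector_mult_add_rdistrib
          matrix_vector_mul_assoc[symmetric])
    then have eq: "(A ** B - mat 1) $ i $ j = ((A - mat 1) ** B) $ i $ j + (B - mat 1) $ i $ j"
      by (simp only: vector_add_component)
    have "v (((A - mat 1) ** B) $ i $ j) < \<epsilon>"
      unfolding matrix_matrix_mult_def vec_lambda_beta
    proof (rule v_sum_less)
      show "v ((A - mat 1) $ i $ k * B $ k $ j) < \<epsilon>" for k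
        using assms(1) SL_group_entry_le[OF assms(2), of k j]
          mult_left_mono[of "v (B $ k $ j)" 1 "v ((A - mat 1) $ i $ k)"]
        unfolding SL_group_carrier v_mult by (smt (verit) v_nonneg mult.right_neutral)
    qed (rule eps)
    moreover have "v ((B - mat 1) $ i $ j) < \<epsilon>" using assms(2) by (simp add: SL_group_carrier)
    ultimately show ?thesis
      unfolding eq using v_add[of "((A - mat 1) ** B) $ i $ j" "(B - mat 1) $ i $ j"] by linarith
  qed
  moreover have "(A ** B) $ i $ j \<in> R" for i j
    using assms unfolding SL_group_carrier matrix_matrix_mult_def by (auto intro: sum_in)
  ultimately show ?thesis
    using assms by (auto simp: SL_group_carrier det_mul)
qed

lemma transvection_in_SL_group:
  assumes "\<tau> ` S \<inter> S = {}" "c \<in> R" "v c < \<epsilon>"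
  shows "transvection S \<tau> c \<in> carrier (SL_group v R \<epsilon>)"
proof -
  have "(transvection S \<tau> c - mat 1) $ i $ j = (if i \<in> S \<and> j = \<tau> i then c else 0)" for i j
    by (simp add: transvection_def mat_def)
  moreover have "transvection S \<tau> c $ i $ j \<in> R" for i j
    using assms(2) by (simp add: transvection_def)
  ultimately show ?thesis
    unfolding SL_group_carrier using assms(3) eps det_transvection[OF assms(1), of c] by simp
qed

end

section \<open>Decomposition of invariant sets\<close>

lemma paradoxicalI:
  assumes "E \<noteq> {}" "E = A \<union> B" "A \<inter> B = {}" "equidecomposable G \<phi> m A E" "equidecomposable G \<phi> l B E"
    and "1 \<le> m" "1 \<le> l" "m + l = s"
  shows "paradoxical G \<phi> s E"
  unfolding paradoxical_def using assms by blast

lemma disjoint_family_on_3: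
  "disjoint_family_on F {..<3::nat} \<longleftrightarrow> F 0 \<inter> F 1 = {} \<and> (F 0 \<union> F 1) \<inter> F 2 = {}"
proof -
  have 3: "{..<3::nat} = {0, 1, 2}" by auto
  show ?thesis unfolding 3 disjoint_family_on_def by auto
qed

lemma UN_lessThan_3: "(\<Union>i<3::nat. F i) = F 0 \<union> F 1 \<union> F 2"
  by (auto simp: numeral_3_eq_3 numeral_2_eq_2 lessThan_Suc)

lemma equidecomposable_3:
  assumes "g \<in> carrier G" "h \<in> carrier G" "k \<in> carrier G" "A = P \<union> Q \<union> S"
    and "P \<inter> Q = {}" "(P \<union> Q) \<inter> S = {}"
    and "B = \<phi> g ` P \<union> \<phi> h ` Q \<union> \<phi> k ` S"
    and "\<phi> g ` P \<inter> \<phi> h ` Q = {}" "(\<phi> g ` P \<union> \<phi> h ` Q) \<inter> \<phi> k ` S = {}"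
  shows "equidecomposable G \<phi> 3 A B"
proof -
  let ?P = "nth [P, Q, S]" and ?g = "nth [g, h, k]"
  let ?Q = "\<lambda>i. \<phi> (?g i) ` ?P i"
  have "disjoint_family_on ?P {..<3}" "A = (\<Union>i<3. ?P i)"
    "disjoint_family_on ?Q {..<3}" "B = (\<Union>i<3. ?Q i)"
    unfolding disjoint_family_on_3 UN_lessThan_3 using assms(4-9) by simp_all
  moreover have "\<forall>i<3. ?g i \<in> carrier G"
    using assms(1-3) by (simp add: numeral_3_eq_3 All_less_Suc)
  ultimately show ?thesis unfolding equidecomposable_def by blast
qed

lemma equidecomposable_2:
  assumes "g \<in> carrier G" "h \<in> carrier G" "A = P \<union> Q" "P \<inter> Q = {}"
    and "B = \<phi> g ` P \<union> \<phi> h ` Q" "\<phi> g ` P \<inter> \<phi> h ` Q = {}"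
  shows "equidecomposable G \<phi> 2 A B"
proof -
  let ?P = "nth [P, Q]" and ?g = "nth [g, h]"
  let ?Q = "\<lambda>i. \<phi> (?g i) ` ?P i"
  have "disjoint_family_on F {..<2::nat} \<longleftrightarrow> F 0 \<inter> F 1 = {}"
       "(\<Union>i<2::nat. F i) = F 0 \<union> F 1" for F :: "nat \<Rightarrow> 'c set"
    by (auto simp: disjoint_family_on_def numeral_2_eq_2 lessThan_Suc)
  then have "disjoint_family_on ?P {..<2}" "A = (\<Union>i<2. ?P i)"
    "disjoint_family_on ?Q {..<2}" "B = (\<Union>i<2. ?Q i)"
    using assms(3-6) by simp_all
  moreover have "\<forall>i<2. ?g i \<in> carrier G"
    using assms(1,2) by (simp add: numeral_2_eq_2 All_less_Suc)
  ultimately show ?thesis unfolding equidecomposable_def by blast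
qed

section \<open>Block diagonal matrices on paired coordinates\<close>

locale paired_coefficients =
  coefficients v R \<epsilon> + absolute_subring R0 w
  for v :: "'a::field \<Rightarrow> real" and R \<epsilon> and R0 :: "'a set" and w +
  fixes N :: 'a and T :: "'n::finite set" and \<sigma> :: "'n \<Rightarrow> 'n"
  assumes N: "N \<in> R0" "4 \<le> w N" "v N < \<epsilon>"
    and R0: "R0 \<subseteq> R"
    and \<sigma>: "i \<in> T \<Longrightarrow> \<sigma> (\<sigma> i) = i" "i \<in> T \<Longrightarrow> \<sigma> i \<notin> T"
begin

abbreviation "G \<equiv> SL_group v R \<epsilon> :: ('a^'n^'n) monoid"

text \<open>The pairwise differences of these four values are big for \<open>w\<close>, while the
  values themselves stay below \<open>\<epsilon>\<close> for \<open>v\<close>.\<close>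

definition e :: "letter \<Rightarrow> 'a" where
  "e l = (if l = (False, False) then 0 else if l = (False, True) then N
     else if l = (True, False) then N\<^sup>2 else N ^ 3)"

definition d :: "letter \<Rightarrow> 'a" where
  "d l = (if snd l then - N else N)"

lemma N_nonzero: "N \<noteq> 0"
  using N by auto

lemma d_inv: "d (letter_inv l) = - d l"
  by (simp add: d_def letter_inv_def)

lemma big_d: "big (d l)"
  using N by (simp add: d_def)

lemma big_mult: "big b \<Longrightarrow> big c \<Longrightarrow> big (b * c)"
  using mult_mono[of 1 "w b" 4 "w c"] by (simp add: w_mult)

lemma big_mult_diff:
  assumes "big b" "big c"
  shows "big (b * c - b)"
proof -
  have "3 \<le> w (c - 1)" using assms w_diff_ge[of c "-1"] by simp
  then have "4 * 3 \<le> w b * w (c - 1)" using assms by (intro mult_mono) auto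
  also have "\<dots> = w (b * (c - 1))" using assms by (simp add: w_mult)
  also have "b * (c - 1) = b * c - b" by (simp add: algebra_simps)
  finally show ?thesis using assms by simp
qed

lemma big_minus: "big c \<Longrightarrow> big (- c)"
  by simp

lemma big_e:
  assumes "k \<noteq> l"
  shows "big (e k - e l)"
proof -
  have bN: "big N" using N by simp
  have b: "big (N * N)" "big (N * (N * N))"
    using bN big_mult by blast+
  have c: "big (N * N - N)" "big (N * (N * N) - N)" "big (N * N * N - N * N)"
    using bN b big_mult_diff by blast+
  have big_swap: "big (y - x)" if "big (x - y)" for x y
    using big_minus[OF that] by simp
  show ?thesis
    using assms bN b c[THEN big_swap] c
    by (cases k; cases l) (auto simp: e_def power2_eq_square power3_eq_cube mult.assoc)
qed

text \<open>For each \<open>i\<close> in \<open>T\<close>, this is a copy of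
  \<open>letter_mat e d l\<close> in the coordinates \<open>i\<close> and \<open>\<sigma> i\<close>;
  the coordinates outside all pairs are fixed.\<close>

definition M :: "letter \<Rightarrow> 'a^'n^'n" where
  "M l = transvection T \<sigma> (e l) ** transvection (\<sigma> ` T) \<sigma> (d l) ** transvection T \<sigma> (- e (letter_inv l))"

definition coords :: "'n \<Rightarrow> 'a^'n \<Rightarrow> 'a^2" where
  "coords i x = vector [x $ i, x $ \<sigma> i]"

lemma coords_eq_0_iff: "coords i x = 0 \<longleftrightarrow> x $ i = 0 \<and> x $ \<sigma> i = 0"
  by (simp add: coords_def vec_eq_iff forall_2)

lemma \<sigma>_disj: "\<sigma> ` T \<inter> T = {}" "\<sigma> ` (\<sigma> ` T) \<inter> \<sigma> ` T = {}"
  using \<sigma> by (auto simp: image_image)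

lemma mat2_vector_nth: "((A :: 'a^2^2) *v y) $ i = A $ i $ 1 * y $ 1 + A $ i $ 2 * y $ 2"
  by (simp add: matrix_vector_mult_def sum_2)

lemma coords_transvection:
  assumes "i \<in> T"
  shows "coords i (transvection T \<sigma> c *v x) = upper_mat c *v coords i x"
    and "coords i (transvection (\<sigma> ` T) \<sigma> c *v x) = lower_mat c *v coords i x"
  using assms \<sigma> \<sigma>_disj(1)
  by (auto simp: coords_def vec_eq_iff forall_2 transvection_mult_nth mat2_vector_nth)

lemma coords_M: "i \<in> T \<Longrightarrow> coords i (M l *v x) = letter_mat e d l *v coords i x"
  by (simp add: M_def letter_mat_def coords_transvection matrix_vector_mul_assoc[symmetric])

lemma coords_word:
  "i \<in> T \<Longrightarrow> coords i (foldr (\<lambda>l. (*v) (M l)) ws x) = word_mat e d ws *v coords i x"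
  by (induction ws) (simp_all add: coords_M matrix_vector_mul_assoc[symmetric])

lemma M_fixed: "i \<notin> T \<union> \<sigma> ` T \<Longrightarrow> (M l *v x) $ i = x $ i"
  by (simp add: M_def matrix_vector_mul_assoc[symmetric] transvection_mult_nth)

lemma word_fixed: "i \<notin> T \<union> \<sigma> ` T \<Longrightarrow> foldr (\<lambda>l. (*v) (M l)) ws x $ i = x $ i"
  by (induction ws) (simp_all add: M_fixed)

lemma v_mult_less:
  assumes "c \<in> R0"
  shows "v (N * c) < \<epsilon>"
proof -
  have "v N * v c \<le> v N * 1" using assms R0 by (intro mult_left_mono v_le_1) auto
  then show ?thesis using N by (simp add: v_mult)
qed

lemma v_e: "v (e l) < \<epsilon>" and v_d: "v (d l) < \<epsilon>" and e_in: "e l \<in> R0" and d_in: "d l \<in> R0"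
  using v_mult_less[of 1] v_mult_less[of N] v_mult_less[of "N * N"] N eps
  by (auto simp: e_def d_def power2_eq_square power3_eq_cube mult.assoc)

lemma M_in: "M l \<in> carrier G"
  unfolding M_def using \<sigma>_disj R0 e_in d_in v_e v_d
  by (intro mult_in_SL_group transvection_in_SL_group) (auto simp: subset_iff)

lemma M_inv: "M (letter_inv l) ** M l = mat 1"
proof -
  have t: "transvection T \<sigma> (- e k) ** (transvection T \<sigma> (e k) ** A) = A"
       "transvection T \<sigma> (e k) ** (transvection T \<sigma> (- e k)) = mat 1"
       "transvection (\<sigma> ` T) \<sigma> (- d k) ** (transvection (\<sigma> ` T) \<sigma> (d k) ** A) = A" for A k
    using \<sigma>_disj by (simp_all add: matrix_mul_assoc transvection_inverse)
  show ?thesis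
    by (simp add: M_def d_inv matrix_mul_assoc[symmetric] t)
qed

end

section \<open>Paradoxes of invariant sets in even and odd dimension\<close>

locale invariant_set = paired_coefficients v R \<epsilon> R0 w N T \<sigma>
  for v :: "'a::field \<Rightarrow> real" and R \<epsilon> and R0 :: "'a set" and w N
    and T :: "'n::finite set" and \<sigma> +
  fixes E :: "('a^'n) set"
  assumes E_nonzero: "0 \<notin> E" and E_nonempty: "E \<noteq> {}"
    \<comment> \<open>The inverse \<open>B\<close> within the group bounds the norm of
      \<open>A *v x\<close> from below, as invariance of spheres requires. The matrices to which
      this is applied have explicit inverses.\<close>
    and E_inv: "A \<in> carrier G \<Longrightarrow> B \<in> carrier G \<Longrightarrow> B ** A = mat 1 \<Longrightarrow> x \<in> E \<Longrightarrow> A *v x \<in> E"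
begin

text \<open>The points of \<open>E\<close> left out here are fixed by every
  \<open>M l\<close>.\<close>

definition X :: "('a^'n) set" where
  "X = {x \<in> E. \<exists>i\<in>T. coords i x \<noteq> 0}"

lemma M_E: "x \<in> E \<Longrightarrow> M l *v x \<in> E"
  using E_inv[OF M_in M_in M_inv] .

text \<open>A single nonzero block suffices: a fixed point \<open>x\<close> of a word would make
  \<open>coords i x\<close> a nonzero fixed vector of its 2x2 matrix.\<close>

sublocale free_action "\<lambda>l. (*v) (M l)" X
proof
  fix x l assume x: "x \<in> X"
  show "M (letter_inv l) *v (M l *v x) = x"
    by (simp add: matrix_vector_mul_assoc M_inv)
  from x obtain i where i: "i \<in> T" "coords i x \<noteq> 0" by (auto simp: X_def)
  have "letter_mat e d (letter_inv l) *v (letter_mat e d l *v coords i x) = coords i x"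
    using letter_mat_inv[of d e l] d_inv by (simp add: matrix_vector_mul_assoc)
  then have "coords i (M l *v x) \<noteq> 0"
    using i by (auto simp: coords_M)
  then show "M l *v x \<in> X" using i x M_E by (auto simp: X_def)
next
  fix x ws assume x: "x \<in> X" and ws: "reduced ws" "ws \<noteq> []"
  from x obtain i where i: "i \<in> T" "coords i x \<noteq> 0" by (auto simp: X_def)
  have "word_mat e d ws *v coords i x \<noteq> coords i x"
    by (rule word_mat_no_fixed_vector) (use big_d big_e d_inv ws i in auto)
  then show "foldr (\<lambda>l. (*v) (M l)) ws x \<noteq> x"
    using coords_word[OF i(1)] by metis
qed

text \<open>No coordinate is left over and \<open>0 \<notin> E\<close>, so \<open>X\<close> is all
  of \<open>E\<close> and \<open>free_paradox\<close> applies with \<open>D\<close> empty.\<close>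

lemma paradoxical_even:
  assumes "T \<union> \<sigma> ` T = UNIV"
  shows "paradoxical G (*v) 4 E"
proof -
  have "x \<in> X" if "x \<in> E" for x
  proof (rule ccontr)
    assume "x \<notin> X"
    then have "x $ i = 0 \<and> x $ \<sigma> i = 0" if "i \<in> T" for i
      using that \<open>x \<in> E\<close> by (auto simp: X_def coords_eq_0_iff)
    then have "x $ i = 0" for i using assms by (metis UNIV_I UnE imageE)
    then have "x = 0" by (simp add: vec_eq_iff)
    then show False using E_nonzero \<open>x \<in> E\<close> by simp
  qed
  then have XE: "X = E" by (auto simp: X_def)
  obtain P1 P2 Q1 Q2 where PQ:
    "P1 \<union> P2 \<union> Q1 \<union> Q2 = X - {}"
    "P1 \<inter> P2 = {}" "Q1 \<inter> Q2 = {}" "(P1 \<union> P2) \<inter> (Q1 \<union> Q2) = {}"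
    "P1 \<union> (*v) (M (False, False)) ` P2 = X" "P1 \<inter> (*v) (M (False, False)) ` P2 = {}"
    "Q1 \<union> (*v) (M (True, False)) ` Q2 = X" "Q1 \<inter> (*v) (M (True, False)) ` Q2 = {}"
    by (rule free_paradox[of "{}"]) auto
  have "equidecomposable G (*v) 2 (P1 \<union> P2) E"
    using PQ XE by (intro equidecomposable_2[OF one_in_SL_group M_in, where P = P1 and Q = P2]) auto
  moreover have "equidecomposable G (*v) 2 (Q1 \<union> Q2) E"
    using PQ XE by (intro equidecomposable_2[OF one_in_SL_group M_in, where P = Q1 and Q = Q2]) auto
  moreover have "E = (P1 \<union> P2) \<union> (Q1 \<union> Q2)"
    using PQ(1) XE by blast
  ultimately show ?thesis
    using PQ(4) by (intro paradoxicalI[OF E_nonempty,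
        where A = "P1 \<union> P2" and B = "Q1 \<union> Q2" and m = 2 and l = 2]) simp_all
qed

lemma paradoxical_odd:
  assumes "UNIV - (T \<union> \<sigma> ` T) = {z}" "T \<noteq> {}"
  shows "paradoxical G (*v) 6 E"
proof -
  from assms(2) obtain j where j: "j \<in> T" by blast
  have z: "z \<notin> T \<union> \<sigma> ` T" and cover: "i = z \<or> i \<in> T \<union> \<sigma> ` T" for i using assms(1) by auto
  have "j \<noteq> z" using j z by auto
  \<comment> \<open>Adding \<open>N\<close> times coordinate \<open>z\<close> to coordinate
    \<open>j\<close> takes every nonzero point of the axis off it.\<close>
  define t where "t = (transvection {j} (\<lambda>_. z) :: 'a \<Rightarrow> 'a^'n^'n)"
  have t_in: "t N \<in> carrier G" "t (- N) \<in> carrier G"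
    unfolding t_def using N R0 \<open>j \<noteq> z\<close> by (auto intro!: transvection_in_SL_group)
  have t_inv: "t N ** t (- N) = mat 1" "t (- N) ** t N = mat 1"
    unfolding t_def using \<open>j \<noteq> z\<close> by (auto intro!: transvection_inverse)
  define L where "L = {x \<in> E. \<forall>i. i \<noteq> z \<longrightarrow> x $ i = 0}"
  \<comment> \<open>The words fix the coordinate \<open>z\<close>, so an orbit meets this translate of the axis at most
    once. It can be left out of the decomposition of \<open>X\<close> and moved back to cover the axis.\<close>
  define D where "D = (*v) (t N) ` L"
  have E_split: "E = X \<union> L" "X \<inter> L = {}"
  proof -
    have "x \<in> X \<longleftrightarrow> (\<exists>i. i \<noteq> z \<and> x $ i \<noteq> 0)" if "x \<in> E" for x
    proof -
      have "x \<in> X \<longleftrightarrow> (\<exists>i\<in>T \<union> \<sigma> ` T. x $ i \<noteq> 0)"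
        using that by (auto simp: X_def coords_eq_0_iff)
      then show ?thesis using z cover by metis
    qed
    then show "E = X \<union> L" "X \<inter> L = {}" by (auto simp: L_def X_def)
  qed
  have tL: "(t N *v x) $ i = (if i = z then x $ z else if i = j then N * x $ z else 0)" if "x \<in> L" for x i
    using that \<open>j \<noteq> z\<close> by (auto simp: t_def transvection_mult_nth L_def)
  have Lz: "x $ z \<noteq> 0" if "x \<in> L" for x
  proof
    assume "x $ z = 0"
    then have "x = 0" using that by (auto simp: L_def vec_eq_iff)
    then show False using that E_nonzero by (auto simp: L_def)
  qed
  have DX: "D \<subseteq> X"
  proof
    fix y assume "y \<in> D"
    then obtain x where x: "x \<in> L" "y = t N *v x" by (auto simp: D_def)
    have "y \<in> E" using x E_inv[OF t_in t_inv(2)] by (auto simp: L_def)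
    moreover have "y $ j \<noteq> 0" using tL[OF x(1)] Lz[OF x(1)] N_nonzero \<open>j \<noteq> z\<close> x(2) by simp
    ultimately show "y \<in> X" using j by (auto simp: X_def coords_eq_0_iff)
  qed
  \<comment> \<open>On \<open>D\<close>, coordinate \<open>j\<close> is \<open>N\<close> times
    coordinate \<open>z\<close>, and the remaining coordinates vanish.\<close>
  have D_eq: "x = y" if xy: "x \<in> D" "y \<in> D" "x $ z = y $ z" for x y
  proof -
    from xy obtain x' y' where "x' \<in> L" "x = t N *v x'" "y' \<in> L" "y = t N *v y'" by (auto simp: D_def)
    then show ?thesis using xy(3) by (simp add: vec_eq_iff tL)
  qed
  obtain P1 P2 Q1 Q2 where PQ:
    "P1 \<union> P2 \<union> Q1 \<union> Q2 = X - D"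
    "P1 \<inter> P2 = {}" "Q1 \<inter> Q2 = {}" "(P1 \<union> P2) \<inter> (Q1 \<union> Q2) = {}"
    "P1 \<union> (*v) (M (False, False)) ` P2 = X" "P1 \<inter> (*v) (M (False, False)) ` P2 = {}"
    "Q1 \<union> (*v) (M (True, False)) ` Q2 = X" "Q1 \<inter> (*v) (M (True, False)) ` Q2 = {}"
  proof (rule free_paradox[OF DX])
    fix x ws assume "x \<in> D" "act ws x \<in> D"
    then show "act ws x = x" using D_eq[of "act ws x" x] word_fixed[OF z] by simp
  qed
  have tD: "(*v) (t (- N)) ` D = L"
    by (simp add: D_def image_image matrix_vector_mul_assoc t_inv)
  have "equidecomposable G (*v) 3 (P1 \<union> L \<union> P2) E"
  \<comment> \<open>\<open>P1\<close> and \<open>L\<close> both stay in place and form one piece;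
    the empty third piece brings the total to six.\<close>
  proof (rule equidecomposable_3[OF one_in_SL_group M_in one_in_SL_group,
        where P = "P1 \<union> L" and Q = P2 and S = "{}"])
    have one: "(*v) (mat 1 :: 'a^'n^'n) ` Y = Y" for Y by auto
    have "P1 \<union> L \<union> (*v) (M (False, False)) ` P2 \<union> {} = X \<union> L" using PQ(5) by blast
    then show "E = (*v) (mat 1) ` (P1 \<union> L) \<union> (*v) (M (False, False)) ` P2 \<union> (*v) (mat 1) ` {}"
      unfolding one using E_split(1) by metis
    have "(*v) (M (False, False)) ` P2 \<subseteq> X" using PQ(5) by blast
    then show "(*v) (mat 1) ` (P1 \<union> L) \<inter> (*v) (M (False, False)) ` P2 = {}"
      unfolding one using PQ(6) E_split(2) by blast
    have "P2 \<subseteq> X" using PQ(1) by blast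
    then show "(P1 \<union> L) \<inter> P2 = {}" using PQ(2) E_split(2) by blast
  qed simp_all
  moreover have "equidecomposable G (*v) 3 (Q1 \<union> Q2 \<union> D) E"
  proof (rule equidecomposable_3[OF one_in_SL_group M_in t_in(2),
        where P = Q1 and Q = Q2 and S = D])
    have one: "(*v) (mat 1 :: 'a^'n^'n) ` Q1 = Q1" by auto
    show "E = (*v) (mat 1) ` Q1 \<union> (*v) (M (True, False)) ` Q2 \<union> (*v) (t (- N)) ` D"
      unfolding one tD PQ(7) by (rule E_split)
    show "(*v) (mat 1) ` Q1 \<inter> (*v) (M (True, False)) ` Q2 = {}"
      unfolding one by (rule PQ)
    show "((*v) (mat 1) ` Q1 \<union> (*v) (M (True, False)) ` Q2) \<inter> (*v) (t (- N)) ` D = {}"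
      unfolding one tD PQ(7) by (rule E_split)
    show "(Q1 \<union> Q2) \<inter> D = {}" using PQ(1) by blast
  qed (simp_all add: PQ(3))
  moreover have "E = (P1 \<union> L \<union> P2) \<union> (Q1 \<union> Q2 \<union> D)"
  proof -
    have "X = P1 \<union> P2 \<union> Q1 \<union> Q2 \<union> D" using PQ(1) DX by blast
    then show ?thesis using E_split(1) by blast
  qed
  moreover have "(P1 \<union> L \<union> P2) \<inter> (Q1 \<union> Q2 \<union> D) = {}"
  proof -
    have "Q1 \<union> Q2 \<union> D \<subseteq> X" "(P1 \<union> P2) \<inter> D = {}" using PQ(1) DX by blast+
    then show ?thesis using PQ(4) E_split(2) by blast
  qed
  ultimately show ?thesis
    by (intro paradoxicalI[OF E_nonempty,
        where A = "P1 \<union> L \<union> P2" and B = "Q1 \<union> Q2 \<union> D" and m = 3 and l = 3]) simp_all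
qed

end

section \<open>Residue characteristic and absolute values\<close>

context nonarch
begin

section \<open>The characteristic of the residue field\<close>

lemma v_of_nat_le: "v (of_nat n) \<le> 1"
proof (induction n)
  case (Suc n)
  then show ?case using v_add[of 1 "of_nat n"] by simp
qed simp

lemma v_of_int_le: "v (of_int k) \<le> 1"
  using v_of_nat_le[of "nat \<bar>k\<bar>"] by (cases "k \<ge> 0") simp_all

lemma cring_integer_ring: "cring (integer_ring v)"
proof (rule cringI)
  show "abelian_group (integer_ring v)"
  proof (rule abelian_groupI)
    fix x y assume "x \<in> carrier (integer_ring v)" "y \<in> carrier (integer_ring v)"
    then show "x \<oplus>\<^bsub>integer_ring v\<^esub> y \<in> carrier (integer_ring v)"
      using v_add[of x y] by (simp add: integer_ring_def integers_of_def)
  next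
    fix x assume "x \<in> carrier (integer_ring v)"
    then show "\<exists>y\<in>carrier (integer_ring v). y \<oplus>\<^bsub>integer_ring v\<^esub> x = \<zero>\<^bsub>integer_ring v\<^esub>"
      by (intro bexI[of _ "- x"]) (simp_all add: integer_ring_def integers_of_def)
  qed (simp_all add: integer_ring_def integers_of_def algebra_simps)
  show "comm_monoid (integer_ring v)"
    by (rule comm_monoidI) (simp_all add: integer_ring_def integers_of_def v_mult mult_le_one mult_ac)
qed (simp add: integer_ring_def algebra_simps)

lemma ideal_max_ideal: "ideal (max_ideal_of v) (integer_ring v)"
proof (rule idealI)
  show "ring (integer_ring v)" using cring_integer_ring by (rule cring.axioms)
  interpret cring "integer_ring v" by (rule cring_integer_ring)
  show "subgroup (max_ideal_of v) (add_monoid (integer_ring v))"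
  proof (rule add.subgroupI)
    fix x assume x: "x \<in> max_ideal_of v"
    have "\<ominus>\<^bsub>integer_ring v\<^esub> x = - x"
      using x by (intro minus_equality) (auto simp: integer_ring_def max_ideal_of_def integers_of_def)
    then show "\<ominus>\<^bsub>integer_ring v\<^esub> x \<in> max_ideal_of v" using x by (simp add: max_ideal_of_def)
  next
    fix x y assume "x \<in> max_ideal_of v" "y \<in> max_ideal_of v"
    then show "x \<oplus>\<^bsub>integer_ring v\<^esub> y \<in> max_ideal_of v"
      using v_add[of x y] by (simp add: integer_ring_def max_ideal_of_def)
  qed (auto simp: integer_ring_def max_ideal_of_def integers_of_def intro!: exI[of _ 0])
  have "v x * v y < 1" if "v x < 1" "v y \<le> 1" for x y
    using mult_left_mono[OF that(2) v_nonneg[of x]] that(1) by simp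
  then show "x \<otimes>\<^bsub>integer_ring v\<^esub> a \<in> max_ideal_of v" "a \<otimes>\<^bsub>integer_ring v\<^esub> x \<in> max_ideal_of v"
    if "a \<in> max_ideal_of v" "x \<in> carrier (integer_ring v)" for a x
    using that by (auto simp: integer_ring_def max_ideal_of_def integers_of_def v_mult mult.commute)
qed

text \<open>The \<open>n\<close>-fold sum of the unit is the coset of \<open>of_nat n\<close>, so it
  vanishes exactly if \<open>of_nat n\<close> lies in the maximal ideal.\<close>

lemma residue_of_nat_eq_0_iff:
  "[n] \<cdot>\<^bsub>residue_field v\<^esub> \<one>\<^bsub>residue_field v\<^esub> = \<zero>\<^bsub>residue_field v\<^esub> \<longleftrightarrow> v (of_nat n) < 1"
proof -
  let ?O = "integer_ring v" and ?I = "max_ideal_of v"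
  interpret ideal ?I ?O by (rule ideal_max_ideal)
  interpret Q: ring "residue_field v"
    unfolding residue_field_def by (rule quotient_is_ring)
  have carr: "of_nat n \<in> carrier ?O" for n
    by (simp add: integer_ring_def integers_of_def v_of_nat_le)
  have Q: "\<zero>\<^bsub>residue_field v\<^esub> = ?I" "\<one>\<^bsub>residue_field v\<^esub> = ?I +>\<^bsub>?O\<^esub> of_nat 1"
    "x \<oplus>\<^bsub>residue_field v\<^esub> y = x <+>\<^bsub>?O\<^esub> y" for x y
    by (simp_all add: residue_field_def FactRing_def integer_ring_def)
  have "[n] \<cdot>\<^bsub>residue_field v\<^esub> \<one>\<^bsub>residue_field v\<^esub> = ?I +>\<^bsub>?O\<^esub> of_nat n" for n
  proof (induction n)
    case 0
    have "of_nat 0 \<in> ?I" by (simp add: max_ideal_of_def)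
    then have "?I +>\<^bsub>?O\<^esub> of_nat 0 = ?I" by (rule a_rcos_zero[OF ideal_max_ideal])
    then show ?case by (simp only: Q.add.nat_pow_0 Q)
  next
    case (Suc n)
    have "[Suc n] \<cdot>\<^bsub>residue_field v\<^esub> \<one>\<^bsub>residue_field v\<^esub> =
      (?I +>\<^bsub>?O\<^esub> of_nat n) <+>\<^bsub>?O\<^esub> (?I +>\<^bsub>?O\<^esub> of_nat 1)"
      unfolding Q.add.nat_pow_Suc Q(3) Suc.IH unfolding Q(2) by (rule refl)
    also have "\<dots> = ?I +>\<^bsub>?O\<^esub> (of_nat n \<oplus>\<^bsub>?O\<^esub> of_nat 1)"
      by (rule a_rcos_sum) (rule carr)+
    finally show ?case by (simp add: integer_ring_def add.commute)
  qed
  moreover have "?I +>\<^bsub>?O\<^esub> of_nat n = ?I \<longleftrightarrow> of_nat n \<in> ?I"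
    using a_coset_join1[OF _ carr a_subgroup] a_rcos_zero[OF ideal_max_ideal] by blast
  ultimately show ?thesis
    by (simp add: Q(1) max_ideal_of_def)
qed

lemma ring_characteristic_residue_field:
  "ring_characteristic (residue_field v) =
     (if \<exists>n>0. v (of_nat n) < 1 then LEAST n. 0 < n \<and> v (of_nat n) < 1 else 0)"
  unfolding ring_characteristic_def residue_of_nat_eq_0_iff by (rule refl)

text \<open>By Bezout, \<open>n\<close> has an inverse \<open>a\<close> modulo the prime
  \<open>CHAR('a)\<close>. The values of \<open>a\<close> and \<open>n\<close> are at most 1 and
  have product 1.\<close>

lemma v_of_nat_lt_CHAR:
  assumes "0 < n" "n < CHAR('a)"
  shows "v (of_nat n) = 1"
proof -
  have "prime CHAR('a)" using assms by (intro prime_CHAR_semidom) auto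
  then have "coprime n CHAR('a)"
    using assms by (metis coprime_commute dvd_imp_le not_less prime_imp_coprime)
  then obtain a b where ab: "a * n = b * CHAR('a) + 1"
    using coprime_bezout_strong[of n "CHAR('a)"] assms
    by (metis add.commute mult.commute coprime_1_right less_one not_less_iff_gr_or_eq)
  have "of_nat a * of_nat n = (of_nat (a * n) :: 'a)" by simp
  also have "\<dots> = 1" unfolding ab by simp
  finally have "v (of_nat a) * v (of_nat n) = 1" by (metis v_mult v_one)
  then show ?thesis
    using mult_right_mono[OF v_of_nat_le[of a] v_nonneg[of "of_nat n"]] v_of_nat_le[of n] by simp
qed

text \<open>A positive \<open>CHAR('a)\<close> would itself be the least positive \<open>n\<close>
  with \<open>v (of_nat n) < 1\<close>, hence equal to the residue characteristic.\<close>

lemma mixed_characteristic: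
  assumes "CHAR('a) \<noteq> ring_characteristic (residue_field v)"
  shows "CHAR('a) = 0" "\<exists>n>0. v (of_nat n) < 1"
proof -
  show char0: "CHAR('a) = 0"
  proof (rule ccontr)
    assume "CHAR('a) \<noteq> 0"
    then have p: "0 < CHAR('a)" "v (of_nat CHAR('a)) < 1" by simp_all
    have "(LEAST n. 0 < n \<and> v (of_nat n) < 1) = CHAR('a)"
    proof (rule Least_equality)
      fix n assume "0 < n \<and> v (of_nat n) < 1"
      then show "CHAR('a) \<le> n" using v_of_nat_lt_CHAR[of n] by force
    qed (use p in simp)
    moreover have "\<exists>n>0. v (of_nat n) < 1" using p by blast
    then have "ring_characteristic (residue_field v) = (LEAST n. 0 < n \<and> v (of_nat n) < 1)"
      unfolding ring_characteristic_residue_field by (rule if_P)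
    ultimately show False using assms by simp
  qed
  show "\<exists>n>0. v (of_nat n) < 1"
  proof (rule ccontr)
    assume "\<not> (\<exists>n>0. v (of_nat n) < 1)"
    then have "ring_characteristic (residue_field v) = 0"
      unfolding ring_characteristic_residue_field by (rule if_not_P)
    then show False using assms char0 by simp
  qed
qed

text \<open>Either no positive natural number has value below 1, or \<open>CHAR('a)\<close> is the
  least one that does, and reduction modulo it leads to \<open>v_of_nat_lt_CHAR\<close>.\<close>

lemma equal_characteristic:
  assumes "CHAR('a) = ring_characteristic (residue_field v)" "of_int k \<noteq> (0 :: 'a)"
  shows "v (of_int k) = 1"
proof -
  define n where "n = nat \<bar>k\<bar>"
  have k: "of_int k = (of_nat n :: 'a) \<or> of_int k = (- of_nat n :: 'a)"
    by (cases "k \<ge> 0") (simp_all add: n_def)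
  have "v (of_nat n) = 1"
  proof (cases "\<exists>m>0. v (of_nat m) < 1")
    case False
    have "n \<noteq> 0"
    proof
      assume "n = 0"
      then show False using assms(2) by (simp add: n_def)
    qed
    then have "\<not> v (of_nat n) < 1" using False by blast
    then show ?thesis using v_of_nat_le[of n] by linarith
  next
    case True
    then have C: "CHAR('a) = (LEAST m. 0 < m \<and> v (of_nat m) < 1)"
      unfolding assms(1) ring_characteristic_residue_field by (rule if_P)
    from True have pos: "0 < CHAR('a)" unfolding C by (rule LeastI2_ex) simp
    have "of_nat n = (of_nat (n div CHAR('a) * CHAR('a) + n mod CHAR('a)) :: 'a)"
      by (simp only: div_mult_mod_eq)
    also have "\<dots> = of_nat (n mod CHAR('a))"
      by (simp only: of_nat_add of_nat_mult of_nat_CHAR mult_zero_right add_0)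
    finally have eq: "of_nat n = (of_nat (n mod CHAR('a)) :: 'a)" .
    have "n mod CHAR('a) \<noteq> 0"
    proof
      assume "n mod CHAR('a) = 0"
      then have "of_nat n = (0 :: 'a)" by (subst eq) simp
      then show False using assms(2) k by simp
    qed
    then have "v (of_nat (n mod CHAR('a))) = 1" using v_of_nat_lt_CHAR[of "n mod CHAR('a)"] pos by simp
    then show ?thesis by (subst eq)
  qed
  then show ?thesis using k by (elim disjE) simp_all
qed

section \<open>Absolute values on the integers and on polynomials over the prime ring\<close>

lemma range_of_int_minus: "x \<in> range of_int \<Longrightarrow> - x \<in> range (of_int :: int \<Rightarrow> 'a)"
proof -
  assume "x \<in> range of_int"
  then obtain a where "x = of_int a" by blast
  then have "- x = of_int (- a)" by simp
  then show ?thesis by blast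
qed

lemma range_of_int_closed:
  assumes "x \<in> range of_int" "y \<in> range of_int"
  shows "x + y \<in> range (of_int :: int \<Rightarrow> 'a)" "x * y \<in> range (of_int :: int \<Rightarrow> 'a)"
proof -
  obtain a b where "x = of_int a" "y = of_int b" using assms by blast
  then have "x + y = of_int (a + b)" "x * y = of_int (a * b)" by simp_all
  then show "x + y \<in> range (of_int :: int \<Rightarrow> 'a)" "x * y \<in> range (of_int :: int \<Rightarrow> 'a)"
    by blast+
qed

text \<open>In characteristic 0 \<open>of_int\<close> is injective, so the ordinary absolute value
  can be carried over to its range.\<close>

lemma absolute_subring_of_int:
  assumes "CHAR('a) = 0"
  obtains w where "absolute_subring (range of_int :: 'a set) w" "\<And>k. w (of_int k) = \<bar>real_of_int k\<bar>"
proof -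
  have inj: "inj (of_int :: int \<Rightarrow> 'a)"
  proof (rule injI)
    fix a b :: int assume eq: "of_int a = (of_int b :: 'a)"
    have "of_nat (nat \<bar>a - b\<bar>) = (0 :: 'a)"
      using eq by (cases "a \<ge> b") (simp_all add: abs_if)
    then have "CHAR('a) dvd nat \<bar>a - b\<bar>" by (simp only: of_nat_eq_0_iff_char_dvd)
    then show "a = b" using assms by simp
  qed
  define w where "w x = \<bar>real_of_int (inv_into UNIV of_int x)\<bar>" for x :: 'a
  have w: "w (of_int k) = \<bar>real_of_int k\<bar>" for k by (simp add: w_def inv_f_f[OF inj])
  have "absolute_subring (range of_int :: 'a set) w"
  proof
    fix x y :: 'a assume "x \<in> range of_int" "y \<in> range of_int"
    then obtain a b where [simp]: "x = of_int a" "y = of_int b" by blast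
    show "x + y \<in> range of_int" "x * y \<in> range of_int"
      by (simp_all add: range_of_int_closed)
    show "w (x + y) \<le> w x + w y" "w (x * y) = w x * w y"
      using w[of "a + b"] w[of "a * b"] by (simp_all add: w abs_mult)
  next
    fix x :: 'a assume "x \<in> range of_int"
    then obtain a where [simp]: "x = of_int a" by blast
    show "- x \<in> range of_int" by (simp add: range_of_int_minus)
    show "w (- x) = w x"
      using w[of "- a"] by (simp add: w)
  qed (use w[of 0] w[of 1] in \<open>auto intro: range_eqI[of _ _ 1]\<close>)
  then show ?thesis using that w by blast
qed

definition prime_polys :: "'a poly set" where
  "prime_polys = {p. \<forall>i. coeff p i \<in> range of_int}"

lemma prime_polys_closed:
  assumes "p \<in> prime_polys" "q \<in> prime_polys"
  shows "p + q \<in> prime_polys" "p * q \<in> prime_polys" "- p \<in> prime_polys"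
proof -
  have sum: "sum f A \<in> range of_int" if "\<And>i. i \<in> A \<Longrightarrow> f i \<in> range of_int" for f :: "nat \<Rightarrow> 'a" and A
    using that
  proof (induction A rule: infinite_finite_induct)
    case (insert a A)
    then show ?case using range_of_int_closed(1)[of "f a" "sum f A"] by simp
  qed (auto intro: range_eqI[of _ _ 0])
  show "p + q \<in> prime_polys" "- p \<in> prime_polys"
    using assms unfolding prime_polys_def by (simp_all add: range_of_int_closed range_of_int_minus)
  have "coeff (p * q) i \<in> range of_int" for i
    unfolding coeff_mult using assms by (intro sum range_of_int_closed) (simp_all add: prime_polys_def)
  then show "p * q \<in> prime_polys" by (simp add: prime_polys_def)
qed

text \<open>A nonzero constant coefficient has value 1 and cannot cancel against
  \<open>t * poly p t\<close>, whose value is below 1. Thus \<open>t\<close> is transcendental over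
  the prime ring.\<close>

lemma poly_prime_polys:
  assumes "CHAR('a) = ring_characteristic (residue_field v)" "v t < 1" "t \<noteq> 0" "p \<in> prime_polys"
  shows "v (poly p t) \<le> 1 \<and> (p \<noteq> 0 \<longrightarrow> poly p t \<noteq> 0)"
  using assms(4)
proof (induction p)
  case (pCons a p)
  from pCons.prems have "coeff (pCons a p) (Suc i) \<in> range of_int" "coeff (pCons a p) 0 \<in> range of_int" for i
    unfolding prime_polys_def by blast+
  then have p: "p \<in> prime_polys" and a: "a \<in> range of_int" by (auto simp: prime_polys_def)
  from a have va: "v a \<le> 1" "a \<noteq> 0 \<Longrightarrow> v a = 1"
    using v_of_int_le equal_characteristic[OF assms(1)] by auto
  from pCons.IH[OF p] have IH: "v (poly p t) \<le> 1" "p \<noteq> 0 \<Longrightarrow> poly p t \<noteq> 0" by auto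
  have "v (t * poly p t) \<le> v t * 1" unfolding v_mult using IH(1) by (intro mult_left_mono) auto
  then have tp: "v (t * poly p t) < 1" using assms(2) by simp
  have "poly (pCons a p) t \<noteq> 0"
  proof (cases "a = 0")
    case True
    then show ?thesis using IH(2) pCons.hyps assms(3) by simp
  next
    case False
    show ?thesis
    proof
      assume "poly (pCons a p) t = 0"
      then have "a = - (t * poly p t)" by (simp add: eq_neg_iff_add_eq_0)
      then show False using va(2)[OF False] tp by simp
    qed
  qed
  moreover have "v (poly (pCons a p) t) \<le> 1"
    using v_add[of a "t * poly p t"] va tp by simp
  ultimately show ?case by blast
qed simp

text \<open>Evaluation at \<open>t\<close> is injective by \<open>poly_prime_polys\<close>, so the
  degree is well defined on the image. The base 4 makes every nonconstant polynomial big.\<close>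

lemma absolute_subring_polys:
  fixes t :: 'a
  assumes "CHAR('a) = ring_characteristic (residue_field v)" "v t < 1" "t \<noteq> 0"
  obtains w where "absolute_subring ((\<lambda>p. poly p t) ` prime_polys) w"
    "\<And>p. p \<in> prime_polys \<Longrightarrow> p \<noteq> 0 \<Longrightarrow> w (poly p t) = 4 ^ degree p"
proof -
  let ?ev = "\<lambda>p. poly p t"
  \<comment> \<open>Zero needs its own case because \<open>degree 0 = 0\<close> would give it the
    value 1.\<close>
  define h where "h p = (if p = 0 then 0 else 4 ^ degree p :: real)" for p :: "'a poly"
  define w where "w x = h (inv_into prime_polys ?ev x)" for x
  have inj: "inj_on ?ev prime_polys"
  proof (rule inj_onI)
    fix p q assume pq: "p \<in> prime_polys" "q \<in> prime_polys" "poly p t = poly q t"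
    then have "p - q \<in> prime_polys" using prime_polys_closed(1)[of p "- q"] prime_polys_closed(3)[of q] by simp
    moreover have "poly (p - q) t = 0" using pq by simp
    ultimately show "p = q" using poly_prime_polys[OF assms, of "p - q"] by auto
  qed
  have w: "w (poly p t) = h p" if "p \<in> prime_polys" for p
    unfolding w_def by (simp add: inv_into_f_f[OF inj that])
  have const: "[:of_int k:] \<in> prime_polys" for k
    by (auto simp: prime_polys_def coeff_pCons split: nat.split intro: range_eqI[of _ _ 0])
  have h: "h (p + q) \<le> h p + h q" "h (p * q) = h p * h q" "h (- p) = h p" for p q
  proof -
    have "(4::real) ^ degree (p + q) \<le> 4 ^ max (degree p) (degree q)"
      by (intro power_increasing degree_add_le_max) simp
    also have "\<dots> \<le> 4 ^ degree p + 4 ^ degree q" by (simp add: max_def)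
    finally show "h (p + q) \<le> h p + h q" by (auto simp: h_def)
    show "h (p * q) = h p * h q" by (simp add: h_def degree_mult_eq power_add)
    show "h (- p) = h p" by (simp add: h_def)
  qed
  have "absolute_subring (?ev ` prime_polys) w"
  proof
    show "1 \<in> ?ev ` prime_polys" using const[of 1] by (intro image_eqI[of _ _ "[:1:]"]) simp_all
    show "w 0 = 0" "w 1 = 1" using w[OF const[of 0]] w[OF const[of 1]] by (simp_all add: h_def)
  next
    fix x y assume "x \<in> ?ev ` prime_polys" "y \<in> ?ev ` prime_polys"
    then obtain p q where pq: "p \<in> prime_polys" "q \<in> prime_polys" "x = poly p t" "y = poly q t" by blast
    have eq: "x + y = poly (p + q) t" "x * y = poly (p * q) t" using pq by simp_all
    show "x + y \<in> ?ev ` prime_polys" "x * y \<in> ?ev ` prime_polys"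
      unfolding eq using prime_polys_closed pq by blast+
    show "w (x + y) \<le> w x + w y" "w (x * y) = w x * w y"
      unfolding eq using pq by (simp_all only: w prime_polys_closed h)
  next
    fix x assume "x \<in> ?ev ` prime_polys"
    then obtain p where p: "p \<in> prime_polys" "x = poly p t" by blast
    have eq: "- x = poly (- p) t" using p by simp
    show "- x \<in> ?ev ` prime_polys" unfolding eq using prime_polys_closed p by blast
    show "w (- x) = w x" unfolding eq using p by (simp only: w prime_polys_closed h)
  qed
  then show ?thesis using that w by (simp add: h_def)
qed

end

section \<open>Pairing the coordinates and choosing \<open>N\<close>\<close>

lemma exists_pairing:
  obtains T :: "'n::finite set" and \<sigma> :: "'n \<Rightarrow> 'n" where
    "\<And>i. i \<in> T \<Longrightarrow> \<sigma> (\<sigma> i) = i" "\<And>i. i \<in> T \<Longrightarrow> \<sigma> i \<notin> T"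
    "card T = CARD('n) div 2" "card (UNIV - (T \<union> \<sigma> ` T)) = CARD('n) mod 2"
proof -
  obtain T :: "'n set" where T: "card T = CARD('n) div 2"
    using obtain_subset_with_card_n[of "CARD('n) div 2" "UNIV :: 'n set"] by auto
  have "card (- T) = CARD('n) - card T" by (simp add: Compl_eq_Diff_UNIV card_Diff_subset)
  then have "card T \<le> card (- T)" using T by linarith
  then obtain T' where T': "T' \<subseteq> - T" "card T' = card T"
    using obtain_subset_with_card_n by metis
  obtain h where h: "bij_betw h T T'"
    using finite_same_card_bij[of T T'] T' by auto
  \<comment> \<open>The inverse matters on \<open>T'\<close> only; at an unpaired coordinate the
    value is arbitrary.\<close>
  define \<sigma> where "\<sigma> i = (if i \<in> T then h i else inv_into T h i)" for i
  have hT: "h i \<in> T'" if "i \<in> T" for i using h that by (auto simp: bij_betw_def)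
  have im: "\<sigma> ` T = T'" using h by (simp add: \<sigma>_def bij_betw_def)
  have "card (T \<union> T') = card T + card T'"
    using T'(1) by (intro card_Un_disjoint) auto
  then have "card (UNIV - (T \<union> T')) = CARD('n) mod 2"
    using T T'(2) by (subst card_Diff_subset) (auto simp: minus_div_mult_eq_mod[symmetric])
  moreover have "\<sigma> i \<notin> T" "\<sigma> (\<sigma> i) = i" if "i \<in> T" for i
    using that hT[OF that] T'(1) h by (auto simp: \<sigma>_def bij_betw_def)
  ultimately show ?thesis using that[of T \<sigma>] T im by blast
qed

context nonarch
begin

lemma exists_power_less:
  assumes "v t < 1" "0 < \<epsilon>"
  obtains k where "1 \<le> k" "v (t ^ k) < \<epsilon>"
proof -
  obtain k where k: "v t ^ k < \<epsilon>" using real_arch_pow_inv[OF assms(2,1)] by blast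
  have "v t ^ Suc k \<le> v t ^ k" using assms(1) by (intro power_decreasing) auto
  then show ?thesis using that[of "Suc k"] k by (simp add: v_power v_mult)
qed

lemma exists_absolute_subring:
  assumes "nontrivial_valuation v" "0 < \<epsilon>"
  obtains R0 w N where "absolute_subring R0 w" "R0 \<subseteq> coefficient_ring v"
    "N \<in> R0" "4 \<le> w N" "v N < \<epsilon>"
proof (cases "CHAR('a) = ring_characteristic (residue_field v)")
  case False
  from mixed_characteristic[OF this] obtain n where char: "CHAR('a) = 0" and n: "n > 0" "v (of_nat n) < 1"
    by blast
  have "n \<noteq> 1" using n by (metis of_nat_1 v_one less_irrefl)
  then have "n \<ge> 2" using n by simp
  obtain k where k: "1 \<le> k" "v (of_nat n ^ k) < \<epsilon>"
    using exists_power_less[OF n(2) assms(2)] .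
  obtain w where w: "absolute_subring (range of_int :: 'a set) w" "\<And>k. w (of_int k) = \<bar>real_of_int k\<bar>"
    using absolute_subring_of_int[OF char] by blast
  have eq: "of_nat n ^ (2 * k) = (of_int (int n ^ (2 * k)) :: 'a)" by simp
  show ?thesis
  \<comment> \<open>As \<open>n \<ge> 2\<close> and \<open>k \<ge> 1\<close>, doubling the exponent
    makes the integer at least 4 and does not increase its value under \<open>v\<close>.\<close>
  proof (rule that[OF w(1), of "of_nat n ^ (2 * k)"])
    show "range of_int \<subseteq> coefficient_ring v" using False by (simp add: coefficient_ring_def)
    show "of_nat n ^ (2 * k) \<in> range (of_int :: int \<Rightarrow> 'a)" unfolding eq by (rule rangeI)
    have "(2::real) ^ 2 \<le> real n ^ 2" using \<open>n \<ge> 2\<close> by (intro power_mono) auto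
    also have "\<dots> \<le> real n ^ (2 * k)" using n k by (intro power_increasing) auto
    also have "\<dots> = w (of_nat n ^ (2 * k))" unfolding eq w by simp
    finally show "4 \<le> w (of_nat n ^ (2 * k))" by simp
    have "v (of_nat n ^ (2 * k)) \<le> v (of_nat n ^ k)"
      unfolding v_power using v_of_nat_le by (intro power_decreasing) auto
    then show "v (of_nat n ^ (2 * k)) < \<epsilon>" using k by simp
  qed
next
  case True
  have "\<exists>t. t \<noteq> 0 \<and> v t < 1"
  proof -
    have "1 \<in> {v x |x. x \<noteq> 0}" using v_one by (auto intro!: exI[of _ 1])
    then obtain x where x: "x \<noteq> 0" "v x \<noteq> 1"
      using assms(1) unfolding nontrivial_valuation_def by blast
    \<comment> \<open>As \<open>v x\<close> is not 1, either \<open>x\<close> or its inverse has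
      value below 1.\<close>
    have "v x * v (inverse x) = 1" using x(1) v_mult[of x "inverse x"] by simp
    then have "v x < 1 \<or> v (inverse x) < 1"
      using x(2) mult_mono[of 1 "v x" 1 "v (inverse x)"]
      by (metis less_1_mult linorder_neqE_linordered_idom mult.right_neutral not_less_iff_gr_or_eq)
    then show ?thesis using x(1) by (auto intro: exI[of _ "inverse x"])
  qed
  then obtain t where t: "t \<noteq> 0" "v t < 1" by blast
  obtain k where k: "1 \<le> k" "v (t ^ k) < \<epsilon>"
    using exists_power_less[OF t(2) assms(2)] .
  obtain w where w: "absolute_subring ((\<lambda>p. poly p t) ` prime_polys) w"
    "\<And>p. p \<in> prime_polys \<Longrightarrow> p \<noteq> 0 \<Longrightarrow> w (poly p t) = 4 ^ degree p"
    using absolute_subring_polys[OF True t(2,1)] by blast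
  have m: "monom 1 k \<in> prime_polys"
    by (auto simp: prime_polys_def intro: range_eqI[of _ _ 0] range_eqI[of _ _ 1])
  have eq: "t ^ k = poly (monom 1 k) t" by (simp add: poly_monom)
  show ?thesis
  proof (rule that[OF w(1), of "t ^ k"])
    show "(\<lambda>p. poly p t) ` prime_polys \<subseteq> coefficient_ring v"
      using poly_prime_polys[OF True t(2,1)] True by (auto simp: coefficient_ring_def integers_of_def)
    show "t ^ k \<in> (\<lambda>p. poly p t) ` prime_polys" unfolding eq using m by blast
    have "(4::real) ^ 1 \<le> 4 ^ k" using k by (intro power_increasing) auto
    also have "\<dots> = w (t ^ k)"
      unfolding eq using w(2)[OF m] by (simp add: degree_monom_eq)
    finally show "4 \<le> w (t ^ k)" by simp
  qed (rule k)
qed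

lemma coefficients_coefficient_ring:
  assumes "0 < \<epsilon>" "\<epsilon> \<le> 1"
  shows "coefficients v (coefficient_ring v) \<epsilon>"
proof
  fix x y assume "x \<in> coefficient_ring v" "y \<in> coefficient_ring v"
  then show "x + y \<in> coefficient_ring v" "x * y \<in> coefficient_ring v"
    using range_of_int_closed v_add[of x y] mult_le_one[of "v x" "v y"]
    by (auto simp: coefficient_ring_def integers_of_def v_mult split: if_splits)
next
  fix x assume "x \<in> coefficient_ring v"
  then show "- x \<in> coefficient_ring v" "v x \<le> 1"
    using range_of_int_minus v_of_int_le
    by (auto simp: coefficient_ring_def integers_of_def split: if_splits)
qed (use assms in \<open>auto simp: coefficient_ring_def integers_of_def intro: range_eqI[of _ _ 1]\<close>)

text \<open>The number of pieces is 4 in even and 6 in odd dimension, according to whether the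
  pairing leaves a coordinate over.\<close>

lemma paradoxical_invariant_set:
  fixes E :: "('a^'n::finite) set" and \<epsilon> :: real
  defines "G \<equiv> SL_group v (coefficient_ring v) \<epsilon> :: ('a^'n^'n) monoid"
  assumes "nontrivial_valuation v" "0 < \<epsilon>" "\<epsilon> \<le> 1" "2 \<le> CARD('n)"
    and E: "0 \<notin> E" "E \<noteq> {}"
    and E_inv: "\<And>A B x. A \<in> carrier G \<Longrightarrow> B \<in> carrier G \<Longrightarrow> B ** A = mat 1 \<Longrightarrow> x \<in> E \<Longrightarrow> A *v x \<in> E"
  shows "paradoxical G (*v) (nat (5 - (-1) ^ CARD('n))) E"
proof -
  obtain T :: "'n set" and \<sigma> where T: "\<And>i. i \<in> T \<Longrightarrow> \<sigma> (\<sigma> i) = i" "\<And>i. i \<in> T \<Longrightarrow> \<sigma> i \<notin> T"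
    "card T = CARD('n) div 2" "card (UNIV - (T \<union> \<sigma> ` T)) = CARD('n) mod 2"
    using exists_pairing by blast
  obtain R0 w N where N: "absolute_subring R0 w" "R0 \<subseteq> coefficient_ring v"
    "N \<in> R0" "4 \<le> w N" "v N < \<epsilon>"
    using exists_absolute_subring[OF assms(2,3)] .
  interpret C: coefficients v "coefficient_ring v" \<epsilon>
    by (rule coefficients_coefficient_ring[OF assms(3,4)])
  interpret A: absolute_subring R0 w by (rule N)
  interpret invariant_set v "coefficient_ring v" \<epsilon> R0 w N T \<sigma> E
    by unfold_locales (use N T E E_inv in \<open>auto simp: G_def\<close>)
  show ?thesis
  proof (cases "even (CARD('n))")
    case True
    then have "T \<union> \<sigma> ` T = UNIV" using T(4) by auto
    then show ?thesis using paradoxical_even True by (simp add: G_def)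
  next
    case False
    then have "card (UNIV - (T \<union> \<sigma> ` T)) = 1" using T(4) by (simp add: odd_iff_mod_2_eq_one)
    then obtain z where "UNIV - (T \<union> \<sigma> ` T) = {z}" by (rule card_1_singletonE)
    \<comment> \<open>Dimension at least 2 leaves room for a pair, so that the axis can be moved off
      itself.\<close>
    moreover have "T \<noteq> {}" using T(3) assms(5) by auto
    ultimately show ?thesis using paradoxical_odd False by (simp add: G_def)
  qed
qed

text \<open>Neither \<open>A\<close> nor \<open>B\<close> increases the norm, and \<open>B\<close>
  takes \<open>A *v x\<close> back to \<open>x\<close>.\<close>

lemma max_norm_preserved:
  fixes A B :: "'a^'n^'n::finite"
  assumes "\<And>i j. v (A $ i $ j) \<le> 1" "\<And>i j. v (B $ i $ j) \<le> 1" "B ** A = mat 1"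
  shows "max_norm v (A *v x) = max_norm v x"
  using max_norm_le[OF assms(1), of x] max_norm_le[OF assms(2), of "A *v x"] assms(3)
  by (simp add: matrix_vector_mul_assoc)

lemma max_norm_zero: "max_norm v (0 :: 'a^'n::finite) = 0"
  by (simp add: max_norm_def)

end

theorem corollary5p3:
  fixes v :: "'a::field \<Rightarrow> real" and \<epsilon> :: real
  assumes "nonarch_valuation v" and "nontrivial_valuation v"
    and "0 < \<epsilon>" and "\<epsilon> \<le> 1"
    and "CARD('n::finite) \<ge> 2"
  defines "G \<equiv> SL_group v (coefficient_ring v) \<epsilon> :: ('a ^ 'n ^ 'n) monoid"
    and "s \<equiv> nat (5 - (-1) ^ CARD('n))"
  shows "(\<forall>\<F> :: ('a ^ 'n) set set.
            \<F> \<noteq> {} \<and> (\<forall>S\<in>\<F>. S \<noteq> {} \<and> (\<exists>r>0. S = zero_sphere v r)) \<longrightarrow>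
            paradoxical G (*v) s (\<Union>\<F>)) \<and>
         paradoxical G (*v) s (UNIV - {0}) \<and>
         paradoxical G (*v) s ({x. \<forall>i. x $ i \<in> integers_of v} - {0})"
proof -
  interpret nonarch v by unfold_locales (rule assms)
  interpret coefficients v "coefficient_ring v" \<epsilon>
    by (rule coefficients_coefficient_ring[OF assms(3,4)])
  note paradox = paradoxical_invariant_set[OF assms(2-5), folded G_def s_def]
  have inj: "A *v x \<noteq> 0" if "B ** A = mat 1" "x \<noteq> 0" for A B :: "'a^'n^'n" and x
    using that by (metis matrix_vector_mul_assoc matrix_vector_mul_lid matrix_vector_mult_0_right)
  have entry: "v (A $ i $ j) \<le> 1" if "A \<in> carrier G" for A i j
    using SL_group_entry_le that by (simp add: G_def)
  have norm: "max_norm v (A *v x) = max_norm v x"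
    if "A \<in> carrier G" "B \<in> carrier G" "B ** A = mat 1" for A B x
    using max_norm_preserved[OF entry[OF that(1)] entry[OF that(2)] that(3)] .
  have one: "(1 :: 'a^'n) \<noteq> 0" by (simp add: vec_eq_iff)
  have "paradoxical G (*v) s (\<Union>\<F>)"
    if \<F>: "\<F> \<noteq> {}" "\<forall>S\<in>\<F>. S \<noteq> {} \<and> (\<exists>r>0. S = zero_sphere v r)" for \<F> :: "('a ^ 'n) set set"
  proof (rule paradox)
    show "0 \<notin> \<Union>\<F>"
      using \<F>(2) by (auto simp: zero_sphere_def max_norm_zero)
    show "\<Union>\<F> \<noteq> {}" using \<F> by auto
    fix A B x assume AB: "A \<in> carrier G" "B \<in> carrier G" "B ** A = mat 1" and "x \<in> \<Union>\<F>"
    then obtain S where S: "S \<in> \<F>" "x \<in> S" by blast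
    then obtain r where "S = zero_sphere v r" using \<F>(2) by blast
    then have "A *v x \<in> S" using S norm[OF AB] by (simp add: zero_sphere_def)
    then show "A *v x \<in> \<Union>\<F>" using S by blast
  qed
  moreover have "paradoxical G (*v) s (UNIV - {0})"
  proof (rule paradox)
    have "1 \<in> UNIV - {0 :: 'a^'n}" using one by simp
    then show "UNIV - {0 :: 'a^'n} \<noteq> {}" by blast
  qed (use inj in auto)
  moreover have "paradoxical G (*v) s ({x. \<forall>i. x $ i \<in> integers_of v} - {0})"
  proof (rule paradox)
    have "1 \<in> {x :: 'a^'n. \<forall>i. x $ i \<in> integers_of v} - {0}"
      using one by (simp add: integers_of_def)
    then show "{x :: 'a^'n. \<forall>i. x $ i \<in> integers_of v} - {0} \<noteq> {}" by blast
    \<comment> \<open>This set is the closed unit ball, so its invariance follows from that of the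
      norm.\<close>
    have iff: "(\<forall>i. x $ i \<in> integers_of v) \<longleftrightarrow> max_norm v x \<le> 1" for x :: "'a^'n"
      unfolding max_norm_def by (subst Max_le_iff) (auto simp: integers_of_def)
    fix A B x assume "A \<in> carrier G" "B \<in> carrier G" "B ** A = mat 1"
      "x \<in> {x :: 'a^'n. \<forall>i. x $ i \<in> integers_of v} - {0}"
    then show "A *v x \<in> {x :: 'a^'n. \<forall>i. x $ i \<in> integers_of v} - {0}"
      using inj norm by (simp add: iff)
  qed simp
  ultimately show ?thesis by blast
qed

end
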